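(* Let $A$ be a finite alphabet with $|A|\ge 2$ and let $F(A)$ be the free group with basis $A$. The average rank of a size $n$ subgroup of $F(A)$ (for the uniform distribution on the set of size $n$ subgroups of $F(A)$) is $$(|A|-1)\,n-|A|\sqrt n+1,$$ with standard deviation $o(\sqrt n)$.
   Context: An $A$-graph is a pair $\Gamma=(V,E)$ with $V$ finite and $E\subseteq V\times A\times V$ such that $(u,a,v),(u,a,v')\in E$ implies $v=v'$, and $(u,a,v),(u',a,v)\in E$ implies $u=u'$. It is connected if its underlying undirected graph is connected. A vertex is a leaf if it occurs at most once in the list of triples defining $E$ (a loop $(v,a,v)$ counts as two occurrences of $v$). Given a vertex $v$, $\Gamma$ is $v$-trim if no vertex $w\neq v$ is a leaf, and the pair $(\Gamma,v)$ is admissible if $\Gamma$ is connected and $v$-trim. By Stallings foldings, each finitely generated subgroup $H\le F(A)$ is represented by an admissible pair $(\Gamma,1)$ (with $1$ a designated vertex), unique up to isomorphism, called the graphical representation of $H$; $H$ is the set of reduced words over $A\sqcup A^{-1}$ labeling closed paths at the vertex $1$ (edges may be traversed backwards, reading the inverse letter). Conversely every admissible pair is the graphical representation of a unique finitely generated subgroup. The size of $H$ is the number of vertices of $\Gamma$; there are finitely many subgroups of each size, and a random size $n$ subgroup is one chosen uniformly among them. One has $\mathrm{rank}(H)=|E(\Gamma)|-|V(\Gamma)|+1$.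
   Formalization: The displayed average rank is proved as an asymptotic value, up to an error o(√n), not as an exact equality, which is false (for n = 1 the average rank is |A|/2, while the formula gives 0). *)

theory Defs
  imports "HOL-Algebra.Generated_Groups" "HOL-Probability.Probability_Mass_Function"
    "HOL-Library.Landau_Symbols"
begin

text \<open>
  The letter \<open>(a, True)\<close> stands for the generator \<open>a\<close> and \<open>(a, False)\<close> for its inverse.
\<close>

type_synonym 'a letter = "'a \<times> bool"

definition inv_letter :: "'a letter \<Rightarrow> 'a letter" where
  "inv_letter x = (fst x, \<not> snd x)"

definition reduced :: "'a letter list \<Rightarrow> bool" where
  "reduced w \<longleftrightarrow> successively (\<lambda>x y. y \<noteq> inv_letter x) w"

fun push :: "'a letter \<Rightarrow> 'a letter list \<Rightarrow> 'a letter list" where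
  "push x [] = [x]"
| "push x (y # w) = (if y = inv_letter x then w else x # y # w)"

definition reduce :: "'a letter list \<Rightarrow> 'a letter list" where
  "reduce w = foldr push w []"

definition free_group :: "'a set \<Rightarrow> 'a letter list monoid" where
  "free_group A =
    \<lparr>carrier = {w. set w \<subseteq> A \<times> UNIV \<and> reduced w},
     monoid.mult = (\<lambda>u v. reduce (u @ v)),
     one = []\<rparr>"

lemma inv_letter_inv_letter [simp]: "inv_letter (inv_letter x) = x"
  by (simp add: inv_letter_def)

lemma inv_letter_neq [simp]: "inv_letter x \<noteq> x" "x \<noteq> inv_letter x"
  by (auto simp: inv_letter_def prod_eq_iff)

lemma reduced_Nil [simp]: "reduced []"
  by (simp add: reduced_def)

lemma reduced_ConsD: "reduced (x # w) \<Longrightarrow> reduced w"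
  by (cases w) (auto simp: reduced_def)

lemma reduced_push: "reduced w \<Longrightarrow> reduced (push x w)"
  by (cases w) (auto simp: reduced_def successively_Cons)

lemma reduced_foldr_push: "reduced w \<Longrightarrow> reduced (foldr push u w)"
  by (induction u) (auto intro: reduced_push)

lemma reduced_reduce: "reduced (reduce w)"
  by (simp add: reduce_def reduced_foldr_push)

lemma push_push_inv: "reduced w \<Longrightarrow> push x (push (inv_letter x) w) = w"
  by (cases w rule: remdups_adj.cases) (auto simp: reduced_def)

lemma reduce_reduced: "reduced w \<Longrightarrow> reduce w = w"
proof (induction w)
  case (Cons x w)
  then show ?case
    by (cases w) (auto simp: reduce_def reduced_def)
qed (simp add: reduce_def)

lemma foldr_push_push:
  "reduced w \<Longrightarrow> foldr push (push x u) w = push x (foldr push u w)"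
  using push_push_inv[of _ x] by (cases u) (auto simp: reduced_foldr_push)

lemma foldr_push_reduce: "reduced w \<Longrightarrow> foldr push (reduce u) w = foldr push u w"
  by (induction u) (auto simp: reduce_def foldr_push_push)

lemma reduce_append: "reduce (u @ v) = foldr push u (reduce v)"
  by (simp add: reduce_def)

lemma reduce_reduce_left: "reduce (reduce u @ v) = reduce (u @ v)"
  by (simp add: reduce_append foldr_push_reduce reduced_reduce)

lemma reduce_reduce_right: "reduce (u @ reduce v) = reduce (u @ v)"
  by (simp add: reduce_append reduce_reduced reduced_reduce)

lemma set_push: "set (push x w) \<subseteq> insert x (set w)"
  by (cases w) auto

lemma set_reduce: "set (reduce w) \<subseteq> set w"
proof (induction w)
  case (Cons x w)
  then show ?case
    using set_push[of x "reduce w"] by (auto simp: reduce_def)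
qed (simp add: reduce_def)

lemma reduce_inverse: "reduce (rev (map inv_letter w) @ w) = []"
proof (induction w)
  case (Cons x w)
  have "foldr push [inv_letter x, x] (reduce w) = reduce w"
    using push_push_inv[OF reduced_reduce, of "inv_letter x" w] by simp
  with Cons show ?case
    by (simp add: reduce_def)
qed (simp add: reduce_def)

lemma group_free_group: "group (free_group A)"
proof (rule groupI)
  fix x y z
  assume "x \<in> carrier (free_group A)" "y \<in> carrier (free_group A)" "z \<in> carrier (free_group A)"
  show "x \<otimes>\<^bsub>free_group A\<^esub> y \<otimes>\<^bsub>free_group A\<^esub> z = x \<otimes>\<^bsub>free_group A\<^esub> (y \<otimes>\<^bsub>free_group A\<^esub> z)"
    by (simp add: free_group_def reduce_reduce_left reduce_reduce_right)
next
  fix x y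
  assume "x \<in> carrier (free_group A)" "y \<in> carrier (free_group A)"
  then show "x \<otimes>\<^bsub>free_group A\<^esub> y \<in> carrier (free_group A)"
    using set_reduce[of "x @ y"] by (auto simp: free_group_def reduced_reduce)
next
  fix x
  assume x: "x \<in> carrier (free_group A)"
  let ?y = "reduce (rev (map inv_letter x))"
  have "set ?y \<subseteq> inv_letter ` set x"
    using set_reduce[of "rev (map inv_letter x)"] by simp
  with x have "?y \<in> carrier (free_group A)"
    by (force simp: free_group_def reduced_reduce inv_letter_def)
  moreover have "?y \<otimes>\<^bsub>free_group A\<^esub> x = \<one>\<^bsub>free_group A\<^esub>"
    by (simp add: free_group_def reduce_reduce_left reduce_inverse)
  ultimately show "\<exists>y\<in>carrier (free_group A). y \<otimes>\<^bsub>free_group A\<^esub> x = \<one>\<^bsub>free_group A\<^esub>"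
    by blast
qed (simp_all add: free_group_def reduce_reduced)

definition fg_subgroup :: "('g, 'b) monoid_scheme \<Rightarrow> 'g set \<Rightarrow> bool" where
  "fg_subgroup G H \<longleftrightarrow> subgroup H G \<and> (\<exists>S. finite S \<and> S \<subseteq> H \<and> generate G S = H)"

text \<open>
  The minimal cardinality of a generating set; for a finitely generated free group, in particular
  for a finitely generated subgroup of a free group, this is the cardinality of any basis.
\<close>

definition subgroup_rank :: "('g, 'b) monoid_scheme \<Rightarrow> 'g set \<Rightarrow> nat" where
  "subgroup_rank G H = (LEAST k. \<exists>S. finite S \<and> S \<subseteq> H \<and> generate G S = H \<and> card S = k)"

definition A_graph :: "'a set \<Rightarrow> 'v set \<Rightarrow> ('v \<times> 'a \<times> 'v) set \<Rightarrow> bool" where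
  "A_graph A V E \<longleftrightarrow>
     finite V \<and> E \<subseteq> V \<times> A \<times> V \<and>
     (\<forall>u a v v'. (u, a, v) \<in> E \<and> (u, a, v') \<in> E \<longrightarrow> v = v') \<and>
     (\<forall>u u' a v. (u, a, v) \<in> E \<and> (u', a, v) \<in> E \<longrightarrow> u = u')"

definition graph_connected :: "'v set \<Rightarrow> ('v \<times> 'a \<times> 'v) set \<Rightarrow> bool" where
  "graph_connected V E \<longleftrightarrow>
     (\<forall>u\<in>V. \<forall>v\<in>V. (u, v) \<in> {(x, y). \<exists>a. (x, a, y) \<in> E \<or> (y, a, x) \<in> E}\<^sup>*)"

definition occurrences :: "('v \<times> 'a \<times> 'v) set \<Rightarrow> 'v \<Rightarrow> nat" where
  "occurrences E w = card {(u, a, v). (u, a, v) \<in> E \<and> u = w} + card {(u, a, v). (u, a, v) \<in> E \<and> v = w}"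

definition is_leaf :: "('v \<times> 'a \<times> 'v) set \<Rightarrow> 'v \<Rightarrow> bool" where
  "is_leaf E w \<longleftrightarrow> occurrences E w \<le> 1"

definition trim_at :: "'v set \<Rightarrow> ('v \<times> 'a \<times> 'v) set \<Rightarrow> 'v \<Rightarrow> bool" where
  "trim_at V E v \<longleftrightarrow> (\<forall>w\<in>V. w \<noteq> v \<longrightarrow> \<not> is_leaf E w)"

definition admissible :: "'a set \<Rightarrow> 'v set \<Rightarrow> ('v \<times> 'a \<times> 'v) set \<Rightarrow> 'v \<Rightarrow> bool" where
  "admissible A V E v \<longleftrightarrow>
     A_graph A V E \<and> v \<in> V \<and> graph_connected V E \<and> trim_at V E v"

inductive walk :: "('v \<times> 'a \<times> 'v) set \<Rightarrow> 'v \<Rightarrow> 'a letter list \<Rightarrow> 'v \<Rightarrow> bool"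
  for E :: "('v \<times> 'a \<times> 'v) set" where
  nil: "walk E u [] u"
| forward: "(u, a, v) \<in> E \<Longrightarrow> walk E v w x \<Longrightarrow> walk E u ((a, True) # w) x"
| backward: "(v, a, u) \<in> E \<Longrightarrow> walk E v w x \<Longrightarrow> walk E u ((a, False) # w) x"

definition graphical_representation ::
    "'a set \<Rightarrow> 'v set \<Rightarrow> ('v \<times> 'a \<times> 'v) set \<Rightarrow> 'v \<Rightarrow> 'a letter list set \<Rightarrow> bool" where
  "graphical_representation A V E v H \<longleftrightarrow>
     admissible A V E v \<and> H = {w. reduced w \<and> walk E v w v}"

text \<open>
  Since vertex sets are finite, every admissible pair is isomorphic to one whose vertices are
  natural numbers.
\<close>

definition subgroups_of_size :: "'a set \<Rightarrow> nat \<Rightarrow> 'a letter list set set" where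
  "subgroups_of_size A n =
     {H. fg_subgroup (free_group A) H \<and>
         (\<exists>(V :: nat set) E v. graphical_representation A V E v H \<and> card V = n)}"

text \<open>
  \<^const>\<open>pmf_of_set\<close> is meaningful here because there are finitely many subgroups of each size
  over a finite alphabet, and at least one of each positive size over a nonempty one.
\<close>

definition random_subgroup :: "'a set \<Rightarrow> nat \<Rightarrow> 'a letter list set pmf" where
  "random_subgroup A n = pmf_of_set (subgroups_of_size A n)"

definition average_rank :: "'a set \<Rightarrow> nat \<Rightarrow> real" where
  "average_rank A n =
     measure_pmf.expectation (random_subgroup A n) (\<lambda>H. real (subgroup_rank (free_group A) H))"

definition rank_std_deviation :: "'a set \<Rightarrow> nat \<Rightarrow> real" where
  "rank_std_deviation A n =
     sqrt (measure_pmf.variance (random_subgroup A n) (\<lambda>H. real (subgroup_rank (free_group A) H)))"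

end

theory Submission
  imports Defs "HOL-Combinatorics.Permutations" "HOL-Analysis.Convex" "HOL-Real_Asymp.Real_Asymp"
begin

text \<open>
  A subgroup of size \<open>n\<close> is an admissible graph up to isomorphism: as every reduced walk from the base
  point extends to a closed one (\<open>reduced_walk_extend\<close>), the subgroup determines which words can be read
  from the base point and which of them end at the same vertex. An isomorphism of admissible
  graphs that preserves the base point is determined by the walks from it, so every subgroup is
  represented by exactly \<open>fact (n - 1)\<close> labelled graphs on \<open>{..<n}\<close> with base point \<open>0\<close>
  (\<open>card_standard_graphs_fibre\<close>). A random subgroup is therefore a uniformly random admissible labelled
  graph \<open>E\<close>, and its rank is \<open>card E - n + 1\<close> (\<open>rank_closed_words\<close>): generators come from a spanning
  tree, and fewer do not suffice because the subgroup has too many homomorphisms to the group of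
  order 2.

  Without the condition of admissibility, a labelled graph is a family of partial injections of
  \<open>{..<n}\<close>, one for each letter, and these are independent. The number \<open>J\<close> of points where a uniformly
  random partial injection is undefined satisfies two identities obtained by adding and removing
  one pair; they show that the mean of \<open>(J - sqrt n)\<^sup>2\<close> is at most \<open>sqrt n + 1\<close>
  (\<open>second_moment_partial_injections\<close>). Since \<open>card E\<close> is \<open>card A * n\<close> minus the sum of the \<open>J\<close>, the second
  moment of \<open>card E\<close> about \<open>card A * (n - sqrt n)\<close> is of order \<open>sqrt n\<close>, far below \<open>n\<close>
  (\<open>second_moment_A_graphs\<close>).

  With at least two letters, the probabilities that a random graph has a leaf
  (\<open>card_A_graphs_leaf_le\<close>) or is disconnected (\<open>card_A_graphs_disconnected_le\<close>) are at most of order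
  \<open>1 / sqrt n\<close>. So for large \<open>n\<close> at least half of the graphs are admissible, and
  conditioning on admissibility at most doubles the second moment. A second moment of order \<open>sqrt n\<close>
  bounds both the squared deviation of the mean and the variance, and gives
  errors of order \<open>n powr (1 / 4)\<close> in both parts of the theorem.
\<close>

section \<open>Partial injections of a finite set\<close>

definition partial_injections :: "'v set \<Rightarrow> ('v \<times> 'v) set set" where
  "partial_injections V = {R. R \<subseteq> V \<times> V \<and> single_valued R \<and> single_valued (R\<inverse>)}"

lemma finite_partial_injections [simp]: "finite V \<Longrightarrow> finite (partial_injections V)"
  unfolding partial_injections_def by (rule finite_subset[of _ "Pow (V \<times> V)"]) auto

lemma empty_in_partial_injections [simp]: "{} \<in> partial_injections V"
  by (simp add: partial_injections_def)

lemma finite_partial_injection: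
  assumes "finite V" "R \<in> partial_injections V"
  shows "finite R"
  using assms unfolding partial_injections_def by (auto intro: finite_subset)

lemma card_Domain_partial_injection:
  assumes "R \<in> partial_injections V"
  shows "card (Domain R) = card R"
proof -
  have "inj_on fst R"
    using assms by (auto simp: partial_injections_def single_valued_def inj_on_def)
  then show ?thesis
    by (simp add: Domain_fst card_image)
qed

lemma card_Range_partial_injection:
  assumes "R \<in> partial_injections V"
  shows "card (Range R) = card R"
proof -
  have "inj_on snd R"
    using assms by (auto simp: partial_injections_def single_valued_def inj_on_def)
  then show ?thesis
    by (simp add: Range_snd card_image)
qed

lemma card_partial_injection_le:
  assumes "finite V" "R \<in> partial_injections V"
  shows "card R \<le> card V"
proof -
  have "Domain R \<subseteq> V"
    using assms by (auto simp: partial_injections_def)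
  then show ?thesis
    using card_mono[OF assms(1)] card_Domain_partial_injection[OF assms(2)] by metis
qed

lemma card_undefined_partial_injection:
  assumes "finite V" "R \<in> partial_injections V"
  shows "card (V - Domain R) = card V - card R" "card (V - Range R) = card V - card R"
proof -
  have "Domain R \<subseteq> V" "Range R \<subseteq> V"
    using assms by (auto simp: partial_injections_def)
  moreover from this have "finite (Domain R)" "finite (Range R)"
    using assms(1) by (auto intro: finite_subset)
  ultimately show "card (V - Domain R) = card V - card R" "card (V - Range R) = card V - card R"
    by (simp_all add: card_Diff_subset card_Domain_partial_injection[OF assms(2)]
        card_Range_partial_injection[OF assms(2)])
qed

text \<open>
  Adding or removing one pair: a pair \<open>e\<close> of a partial injection \<open>R\<close> corresponds to a pair of points,
  one outside the domain and one outside the range of \<open>R - {e}\<close>. With \<open>J\<close> undefined points there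
  are \<open>J\<^sup>2\<close> such pairs. Different weights \<open>f\<close> turn this single double count into the number of
  partial injections and into the moments of \<open>J\<close>.
\<close>

lemma sum_partial_injections_shift:
  fixes f :: "nat \<Rightarrow> real"
  assumes V: "finite V"
  shows "(\<Sum>R\<in>partial_injections V. real (card R) * f (card R)) =
         (\<Sum>R\<in>partial_injections V. real ((card V - card R)\<^sup>2) * f (Suc (card R)))"
proof -
  let ?P = "partial_injections V"
  have "(\<Sum>R\<in>?P. real (card R) * f (card R)) = (\<Sum>R\<in>?P. \<Sum>e\<in>R. f (card R))"
    by simp
  also have "\<dots> = (\<Sum>(R, e)\<in>(SIGMA R:?P. R). f (card R))"
    using V by (subst sum.Sigma) (auto intro: finite_partial_injection)
  also have "\<dots> = (\<Sum>(R, e)\<in>(SIGMA R:?P. (V - Domain R) \<times> (V - Range R)). f (Suc (card R)))"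
  proof (rule sum.reindex_bij_witness[where
        i = "\<lambda>(R, e). (insert e R, e)" and j = "\<lambda>(R, e). (R - {e}, e)"], goal_cases)
    case (1 p)
    then show ?case by auto
  next
    case (2 p)
    then show ?case
      by (auto simp: partial_injections_def single_valued_def)
  next
    case (3 p)
    then show ?case by auto
  next
    case (4 p)
    then show ?case
      by (auto simp: partial_injections_def single_valued_def)
  next
    case (5 p)
    then obtain R e where p: "p = (R, e)" "R \<in> ?P" "e \<in> R" by auto
    with V have "card R = Suc (card (R - {e}))"
      by (metis card_Suc_Diff1 finite_partial_injection)
    then show ?case
      using p by simp
  qed
  also have "\<dots> = (\<Sum>R\<in>?P. \<Sum>e\<in>(V - Domain R) \<times> (V - Range R). f (Suc (card R)))"
    using V by (subst sum.Sigma) auto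
  also have "\<dots> = (\<Sum>R\<in>?P. real ((card V - card R)\<^sup>2) * f (Suc (card R)))"
  proof (rule sum.cong)
    fix R assume "R \<in> ?P"
    then show "(\<Sum>e\<in>(V - Domain R) \<times> (V - Range R). f (Suc (card R))) =
               real ((card V - card R)\<^sup>2) * f (Suc (card R))"
      using card_undefined_partial_injection[OF V, of R]
      by (simp add: card_cartesian_product power2_eq_square)
  qed simp
  finally show ?thesis .
qed

lemma card_partial_injections_size:
  assumes "finite V" "m \<le> card V"
  shows "card {R \<in> partial_injections V. card R = m} = (card V choose m)\<^sup>2 * fact m"
  using assms(2)
proof (induction m)
  case 0
  have "{R \<in> partial_injections V. card R = 0} = {{}}"
    using finite_partial_injection[OF assms(1)] by auto
  then show ?case by simp
next
  case (Suc m)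
  let ?P = "partial_injections V" and ?n = "card V"
  let ?t = "\<lambda>m. card {R \<in> ?P. card R = m}"
  have sum1: "(\<Sum>R\<in>?P. h R * of_bool (card R = k)) = (\<Sum>R\<in>{R \<in> ?P. card R = k}. h R)"
    for h :: "('a \<times> 'a) set \<Rightarrow> real" and k
    using assms(1) by (intro sum.mono_neutral_cong_right) auto
  have "real (Suc m * ?t (Suc m)) = (\<Sum>R\<in>?P. real (card R) * of_bool (card R = Suc m))"
    by (simp add: sum1 algebra_simps)
  also have "\<dots> = (\<Sum>R\<in>?P. real ((?n - card R)\<^sup>2) * of_bool (card R = m))"
    using sum_partial_injections_shift[OF assms(1), of "\<lambda>k. of_bool (k = Suc m)"] by simp
  also have "\<dots> = real ((?n - m)\<^sup>2 * ?t m)"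
    unfolding sum1 by simp
  finally have "Suc m * ?t (Suc m) = (?n - m)\<^sup>2 * ?t m"
    by (simp only: of_nat_eq_iff)
  also have "\<dots> = ((?n - m) * (?n choose m))\<^sup>2 * fact m"
    using Suc by (simp add: power_mult_distrib)
  also have "(?n - m) * (?n choose m) = Suc m * (?n choose Suc m)"
    by (metis binomial_absorb_comp binomial_absorption mult.commute)
  also have "(Suc m * (?n choose Suc m))\<^sup>2 * fact m = Suc m * ((?n choose Suc m)\<^sup>2 * fact (Suc m))"
    by (simp add: power2_eq_square algebra_simps)
  finally show ?case
    by (simp only: mult_cancel1) simp
qed

text \<open>
  The value at \<open>-1\<close> of the Laguerre polynomial of degree \<open>n\<close>.
\<close>

definition laguerre :: "nat \<Rightarrow> real" where
  "laguerre n = (\<Sum>j\<le>n. real (n choose j) / fact j)"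

lemma card_partial_injections:
  assumes "finite V"
  shows "real (card (partial_injections V)) = fact (card V) * laguerre (card V)"
proof -
  let ?P = "partial_injections V" and ?n = "card V"
  have "?P = (\<Union>m\<le>?n. {R \<in> ?P. card R = m})"
    using card_partial_injection_le[OF assms] by auto
  moreover have "card (\<Union>m\<le>?n. {R \<in> ?P. card R = m}) = (\<Sum>m\<le>?n. card {R \<in> ?P. card R = m})"
    using assms by (intro card_UN_disjoint) auto
  ultimately have "card ?P = (\<Sum>m\<le>?n. (?n choose m)\<^sup>2 * fact m)"
    using card_partial_injections_size[OF assms] by simp
  then have "real (card ?P) = (\<Sum>m\<le>?n. real ((?n choose m)\<^sup>2 * fact m))"
    by simp
  also have "\<dots> = (\<Sum>j\<le>?n. real ((?n choose j)\<^sup>2 * fact (?n - j)))"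
    by (rule sum.reindex_bij_witness[where i = "\<lambda>j. ?n - j" and j = "\<lambda>j. ?n - j"])
      (auto simp flip: binomial_symmetric)
  also have "\<dots> = (\<Sum>j\<le>?n. fact ?n * (real (?n choose j) / fact j))"
  proof (rule sum.cong)
    fix j assume "j \<in> {..?n}"
    then have "(fact ?n :: real) = fact j * fact (?n - j) * real (?n choose j)"
      by (simp add: binomial_fact)
    then show "real ((?n choose j)\<^sup>2 * fact (?n - j)) = fact ?n * (real (?n choose j) / fact j)"
      by (simp add: power2_eq_square)
  qed simp
  finally show ?thesis
    by (simp add: laguerre_def sum_distrib_left)
qed

lemma laguerre_ge_1: "laguerre n \<ge> 1"
proof -
  have "(\<Sum>j\<in>{0}. real (n choose j) / fact j) \<le> laguerre n"
    unfolding laguerre_def by (rule sum_mono2) auto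
  then show ?thesis by simp
qed

lemma laguerre_mono:
  assumes "m \<le> n"
  shows "laguerre m \<le> laguerre n"
proof -
  have "laguerre m \<le> (\<Sum>j\<le>m. real (n choose j) / fact j)"
    unfolding laguerre_def using assms by (intro sum_mono divide_right_mono) (auto simp: binomial_right_mono)
  also have "\<dots> \<le> laguerre n"
    unfolding laguerre_def using assms by (intro sum_mono2) auto
  finally show ?thesis .
qed

text \<open>
  The true growth is \<open>exp (2 * sqrt n)\<close> up to a power of \<open>n\<close>; an exponential bound
  whose rate can be made as small as desired suffices, and it follows from the binomial theorem since every term
  \<open>(1 / x) ^ j / fact j\<close> is at most \<open>exp (1 / x)\<close>.
\<close>

lemma laguerre_le:
  assumes "x > 0"
  shows "laguerre n \<le> exp (1 / x) * (1 + x) ^ n"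
proof -
  have *: "1 / fact j \<le> exp (1 / x) * x ^ j" for j :: nat
  proof -
    have "(1 / x) ^ j / fact j \<le> exp (1 / x)"
      using sum_le_suminf[OF summable_exp_generic[of "1 / x"], of "{j}"] assms
      by (simp add: exp_def divide_inverse mult_ac)
    then show ?thesis
      using assms by (simp add: field_simps)
  qed
  have "laguerre n \<le> (\<Sum>j\<le>n. real (n choose j) * (exp (1 / x) * x ^ j))"
    unfolding laguerre_def using mult_left_mono[OF *] by (intro sum_mono) (simp add: divide_inverse)
  also have "\<dots> = exp (1 / x) * (\<Sum>j\<le>n. real (n choose j) * x ^ j * 1 ^ (n - j))"
    by (simp add: sum_distrib_left mult_ac)
  also have "(\<Sum>j\<le>n. real (n choose j) * x ^ j * 1 ^ (n - j)) = (x + 1) ^ n"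
    by (rule binomial_ring[symmetric])
  finally show ?thesis by (simp add: add.commute)
qed

lemma card_partial_injections_Diff_le:
  assumes "finite V" "w \<in> V"
  shows "real (card V) * real (card (partial_injections (V - {w}))) \<le> real (card (partial_injections V))"
proof -
  obtain m where m: "card V = Suc m"
    using assms by (metis card_Suc_Diff1)
  then have "card (V - {w}) = m"
    using assms by simp
  then show ?thesis
    using assms m laguerre_mono[of m "Suc m"] by (simp add: card_partial_injections algebra_simps flip: of_nat_Suc)
qed

text \<open>
  Weight \<open>1\<close> in the double count: the mean of \<open>J\<^sup>2\<close> is the mean of \<open>n - J\<close>.
\<close>

lemma sum_undefined_partial_injections_squared:
  assumes V: "finite V"
  shows "(\<Sum>R\<in>partial_injections V. (real (card V) - real (card R))\<^sup>2) =
         (\<Sum>R\<in>partial_injections V. real (card R))"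
proof -
  have "(real (card V) - real (card R))\<^sup>2 = real ((card V - card R)\<^sup>2)"
    if "R \<in> partial_injections V" for R
    using card_partial_injection_le[OF V that] by (simp add: of_nat_diff)
  then show ?thesis
    using sum_partial_injections_shift[OF V, of "\<lambda>_. 1"] by simp
qed

text \<open>
  Weight \<open>1 / (J + 1)\<close> in the double count shows that \<open>J\<close> and \<open>(n - J) / (J + 1)\<close> have the same mean,
  that is, the mean of \<open>J + 1\<close> is \<open>n + 1\<close> times the mean of \<open>1 / (J + 1)\<close>. By convexity its square is
  at least \<open>n + 1\<close>.
\<close>

lemma sum_undefined_partial_injections_ge:
  assumes V: "finite V"
  shows "(\<Sum>R\<in>partial_injections V. real (card V) - real (card R)) \<ge>
         real (card (partial_injections V)) * (sqrt (real (card V)) - 1)"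
proof -
  let ?P = "partial_injections V" and ?n = "real (card V)"
  let ?J = "\<lambda>R. ?n - real (card R)"
  define c where "c = sqrt (?n + 1)"
  have c: "c > 0" "c * c = ?n + 1"
    by (simp_all add: c_def)
  have "(\<Sum>R\<in>?P. real (card R) * (1 / (?J R + 1))) =
        (\<Sum>R\<in>?P. real ((card V - card R)\<^sup>2) * (1 / (?n - real (Suc (card R)) + 1)))"
    by (rule sum_partial_injections_shift[OF V])
  also have "\<dots> = (\<Sum>R\<in>?P. ?J R)"
  proof (rule sum.cong)
    fix R assume "R \<in> ?P"
    from card_partial_injection_le[OF V this] obtain k where "card V = card R + k"
      using le_Suc_ex by blast
    then show "real ((card V - card R)\<^sup>2) * (1 / (?n - real (Suc (card R)) + 1)) = ?J R"
      by (simp add: power2_eq_square)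
  qed simp
  finally have *: "(\<Sum>R\<in>?P. real (card R) * (1 / (?J R + 1))) = (\<Sum>R\<in>?P. ?J R)" .
  have "2 * c - (?J R + 1) \<le> real (card R) * (1 / (?J R + 1)) + 1" if "R \<in> ?P" for R
  proof -
    define y where "y = ?J R + 1"
    have y: "y > 0" "real (card R) = c * c - y"
      using card_partial_injection_le[OF V that] by (auto simp: y_def c)
    \<comment> \<open>the tangent of \<open>1 / y\<close> at \<open>y = c\<close> lies below the curve\<close>
    have "0 \<le> (c - y)\<^sup>2" by simp
    then have "2 * c - y \<le> (c * c - y) * (1 / y) + 1"
      using y(1) by (simp add: field_simps power2_eq_square)
    then have "2 * c - y \<le> real (card R) * (1 / y) + 1"
      by (simp only: y(2))
    then show ?thesis
      by (simp only: y_def)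
  qed
  then have "(\<Sum>R\<in>?P. 2 * c - (?J R + 1)) \<le> (\<Sum>R\<in>?P. real (card R) * (1 / (?J R + 1)) + 1)"
    by (rule sum_mono)
  also have "\<dots> = (\<Sum>R\<in>?P. ?J R) + real (card ?P)"
    by (subst sum.distrib) (simp only: * sum_constant mult_1_right)
  also have "(\<Sum>R\<in>?P. 2 * c - (?J R + 1)) = real (card ?P) * (2 * c - 1) - (\<Sum>R\<in>?P. ?J R)"
    by (simp add: sum_subtractf sum.distrib algebra_simps)
  finally have "real (card ?P) * (2 * c - 1) - real (card ?P) \<le> 2 * (\<Sum>R\<in>?P. ?J R)"
    by linarith
  moreover have "real (card ?P) * (2 * c - 1) - real (card ?P) = 2 * (real (card ?P) * (c - 1))"
    by (simp add: algebra_simps)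
  ultimately have "real (card ?P) * (c - 1) \<le> (\<Sum>R\<in>?P. ?J R)"
    by linarith
  moreover have "real (card ?P) * (sqrt ?n - 1) \<le> real (card ?P) * (c - 1)"
    by (intro mult_left_mono) (simp_all add: c_def)
  ultimately show ?thesis
    by linarith
qed

lemma sum_undefined_partial_injections_le:
  assumes V: "finite V"
  shows "(\<Sum>R\<in>partial_injections V. real (card V) - real (card R)) \<le>
         real (card (partial_injections V)) * sqrt (real (card V))"
proof (cases "card V = 0")
  case False
  let ?P = "partial_injections V" and ?n = "real (card V)"
  let ?J = "\<lambda>R. ?n - real (card R)" and ?s = "sqrt (real (card V))"
  have s: "?s > 0" "?s * ?s = ?n"
    using False by auto
  have J: "?J R \<ge> 0" if "R \<in> ?P" for R
    using card_partial_injection_le[OF V that] by simp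
  have "2 * ?s * ?J R \<le> (?J R)\<^sup>2 + ?n" for R :: "('a \<times> 'a) set"
    using s(2) zero_le_power2[of "?J R - ?s"] by (simp add: power2_eq_square algebra_simps)
  then have "(\<Sum>R\<in>?P. 2 * ?s * ?J R) \<le> (\<Sum>R\<in>?P. (?J R)\<^sup>2 + ?n)"
    by (intro sum_mono)
  also have "\<dots> = (\<Sum>R\<in>?P. real (card R)) + real (card ?P) * ?n"
    using sum_undefined_partial_injections_squared[OF V] by (simp add: sum.distrib)
  also have "\<dots> \<le> (\<Sum>R\<in>?P. ?n) + real (card ?P) * ?n"
    using card_partial_injection_le[OF V] by (intro add_right_mono sum_mono) simp
  finally have "2 * ?s * (\<Sum>R\<in>?P. ?J R) \<le> 2 * ?s * (real (card ?P) * ?s)"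
    using s(2) by (simp add: sum_distrib_left mult_ac)
  then show ?thesis
    using s(1) by simp
next
  case True
  then have "card R = 0" if "R \<in> partial_injections V" for R
    using card_partial_injection_le[OF V that] by simp
  with True show ?thesis by simp
qed

text \<open>
  The exact relation between the first two moments turns the lower bound for the mean of \<open>J\<close> into
  concentration: the mean of \<open>(J - sqrt n)\<^sup>2\<close> equals \<open>2 * n\<close> minus \<open>2 * sqrt n + 1\<close> times the mean
  of \<open>J\<close>, and the terms of order \<open>n\<close> cancel.
\<close>

lemma second_moment_partial_injections:
  assumes V: "finite V"
  shows "(\<Sum>R\<in>partial_injections V. (real (card V) - real (card R) - sqrt (real (card V)))\<^sup>2) \<le>
         real (card (partial_injections V)) * (sqrt (real (card V)) + 1)"
proof -
  let ?P = "partial_injections V" and ?n = "real (card V)"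
  let ?J = "\<lambda>R. ?n - real (card R)" and ?s = "sqrt (real (card V))" and ?N = "real (card (partial_injections V))"
  have s: "?s \<ge> 0" "?s * ?s = ?n"
    by auto
  have "(?J R - ?s)\<^sup>2 = (?J R)\<^sup>2 - 2 * ?s * ?J R + ?n" for R :: "('a \<times> 'a) set"
    using s(2) by (simp add: power2_eq_square algebra_simps)
  then have "(\<Sum>R\<in>?P. (?J R - ?s)\<^sup>2) = (\<Sum>R\<in>?P. (?J R)\<^sup>2) - 2 * ?s * (\<Sum>R\<in>?P. ?J R) + ?N * ?n"
    by (simp add: sum.distrib sum_subtractf[of _ "\<lambda>R. 2 * ?s * ?J R"] flip: sum_distrib_left)
  also have "(\<Sum>R\<in>?P. (?J R)\<^sup>2) = ?N * ?n - (\<Sum>R\<in>?P. ?J R)"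
    using sum_undefined_partial_injections_squared[OF V] by (simp add: sum_subtractf)
  also have "?N * ?n - (\<Sum>R\<in>?P. ?J R) - 2 * ?s * (\<Sum>R\<in>?P. ?J R) + ?N * ?n =
      2 * (?N * ?n) - (2 * ?s + 1) * (\<Sum>R\<in>?P. ?J R)"
    by (simp add: algebra_simps)
  also have "\<dots> \<le> 2 * (?N * ?n) - (2 * ?s + 1) * (?N * (?s - 1))"
    using sum_undefined_partial_injections_ge[OF V] s(1) by (intro diff_left_mono mult_left_mono) auto
  also have "\<dots> = ?N * (?s + 1) + 2 * ?N * (?n - ?s * ?s)"
    by (simp add: algebra_simps)
  finally show ?thesis
    by simp
qed

section \<open>Graphs as families of partial injections\<close>

definition slice :: "('v \<times> 'a \<times> 'v) set \<Rightarrow> 'a \<Rightarrow> ('v \<times> 'v) set" where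
  "slice E a = {(u, v). (u, a, v) \<in> E}"

definition A_graphs :: "'a set \<Rightarrow> 'v set \<Rightarrow> ('v \<times> 'a \<times> 'v) set set" where
  "A_graphs A V = {E. A_graph A V E}"

lemma A_graph_finite: "A_graph A V E \<Longrightarrow> finite V"
  unfolding A_graph_def by (elim conjE)

lemma A_graph_subset: "A_graph A V E \<Longrightarrow> E \<subseteq> V \<times> A \<times> V"
  unfolding A_graph_def by (elim conjE)

lemma A_graph_forward_unique:
  assumes "A_graph A V E" "(u, a, v) \<in> E" "(u, a, v') \<in> E"
  shows "v = v'"
proof -
  have "\<forall>u a v v'. (u, a, v) \<in> E \<and> (u, a, v') \<in> E \<longrightarrow> v = v'"
    using assms(1) unfolding A_graph_def by (elim conjE)
  with assms(2,3) show ?thesis by blast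
qed

lemma A_graph_backward_unique:
  assumes "A_graph A V E" "(u, a, v) \<in> E" "(u', a, v) \<in> E"
  shows "u = u'"
proof -
  have "\<forall>u u' a v. (u, a, v) \<in> E \<and> (u', a, v) \<in> E \<longrightarrow> u = u'"
    using assms(1) unfolding A_graph_def by (elim conjE)
  with assms(2,3) show ?thesis by blast
qed

lemma A_graphI:
  assumes "finite V" "E \<subseteq> V \<times> A \<times> V"
    and "\<And>u a v v'. (u, a, v) \<in> E \<Longrightarrow> (u, a, v') \<in> E \<Longrightarrow> v = v'"
    and "\<And>u u' a v. (u, a, v) \<in> E \<Longrightarrow> (u', a, v) \<in> E \<Longrightarrow> u = u'"
  shows "A_graph A V E"
  unfolding A_graph_def using assms(1,2) by (intro conjI allI impI; (elim conjE)?) (assumption | erule (1) assms(3,4))+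

lemma A_graph_iff_slices:
  assumes "finite V"
  shows "A_graph A V E \<longleftrightarrow> E \<subseteq> V \<times> A \<times> V \<and> (\<forall>a\<in>A. slice E a \<in> partial_injections V)"
proof
  assume "A_graph A V E"
  note * = A_graph_subset[OF this]
    and det = A_graph_forward_unique[OF this] and codet = A_graph_backward_unique[OF this]
  have "single_valued (slice E a)" "single_valued ((slice E a)\<inverse>)" "slice E a \<subseteq> V \<times> V" for a
    using * by (auto intro!: single_valuedI simp: slice_def dest: det codet)
  with * show "E \<subseteq> V \<times> A \<times> V \<and> (\<forall>a\<in>A. slice E a \<in> partial_injections V)"
    by (simp add: partial_injections_def)
next
  assume *: "E \<subseteq> V \<times> A \<times> V \<and> (\<forall>a\<in>A. slice E a \<in> partial_injections V)"
  have "v = v'" if "(u, a, v) \<in> E" "(u, a, v') \<in> E" for u a v v'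
  proof -
    have "single_valued (slice E a)"
      using * that by (auto simp: partial_injections_def)
    with that show ?thesis
      by (auto simp: slice_def single_valued_def)
  qed
  moreover have "u = u'" if "(u, a, v) \<in> E" "(u', a, v) \<in> E" for u u' a v
  proof -
    have "single_valued ((slice E a)\<inverse>)"
      using * that by (auto simp: partial_injections_def)
    with that show ?thesis
      by (auto simp: slice_def single_valued_def)
  qed
  ultimately show "A_graph A V E"
    using * assms by (intro A_graphI) auto
qed

lemma finite_A_graphs:
  assumes "finite A" "finite V"
  shows "finite (A_graphs A V)"
proof (rule finite_subset)
  show "A_graphs A V \<subseteq> Pow (V \<times> A \<times> V)"
    by (auto simp: A_graphs_def dest: A_graph_subset)
qed (use assms in simp)

text \<open>
  The slices of a uniformly random graph are independent, uniformly random partial injections.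
\<close>

lemma card_A_graphs_slices:
  assumes "finite A" "finite V" and Q: "\<And>a. a \<in> A \<Longrightarrow> Q a \<subseteq> partial_injections V"
  shows "card {E \<in> A_graphs A V. \<forall>a\<in>A. slice E a \<in> Q a} = (\<Prod>a\<in>A. card (Q a))"
proof -
  have "bij_betw (\<lambda>E. restrict (slice E) A) {E \<in> A_graphs A V. \<forall>a\<in>A. slice E a \<in> Q a} (PiE A Q)"
  proof (rule bij_betwI[where g = "\<lambda>F. {(u, a, v). a \<in> A \<and> (u, v) \<in> F a}"])
    show "(\<lambda>E. restrict (slice E) A) \<in> {E \<in> A_graphs A V. \<forall>a\<in>A. slice E a \<in> Q a} \<rightarrow> PiE A Q"
      by auto
    have *: "slice {(u, a, v). a \<in> A \<and> (u, v) \<in> F a} a = F a" if "a \<in> A" for F a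
      using that by (auto simp: slice_def)
    show "(\<lambda>F. {(u, a, v). a \<in> A \<and> (u, v) \<in> F a}) \<in>
          PiE A Q \<rightarrow> {E \<in> A_graphs A V. \<forall>a\<in>A. slice E a \<in> Q a}"
    proof
      fix F assume F: "F \<in> PiE A Q"
      then have F': "F a \<in> partial_injections V" if "a \<in> A" for a
        using Q that by (auto simp: PiE_def Pi_def)
      then have "{(u, a, v). a \<in> A \<and> (u, v) \<in> F a} \<subseteq> V \<times> A \<times> V"
        by (auto simp: partial_injections_def)
      with F F' show "{(u, a, v). a \<in> A \<and> (u, v) \<in> F a} \<in> {E \<in> A_graphs A V. \<forall>a\<in>A. slice E a \<in> Q a}"
        using assms by (auto simp: A_graphs_def A_graph_iff_slices *)
    qed
    show "{(u, a, v). a \<in> A \<and> (u, v) \<in> restrict (slice E) A a} = E"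
      if "E \<in> {E \<in> A_graphs A V. \<forall>a\<in>A. slice E a \<in> Q a}" for E
    proof -
      from that have "E \<subseteq> V \<times> A \<times> V"
        by (auto simp: A_graphs_def dest: A_graph_subset)
      then show ?thesis by (auto simp: slice_def)
    qed
    show "restrict (slice {(u, a, v). a \<in> A \<and> (u, v) \<in> F a}) A = F" if "F \<in> PiE A Q" for F
    proof
      fix a
      show "restrict (slice {(u, a, v). a \<in> A \<and> (u, v) \<in> F a}) A a = F a"
        using that *[of a F] by (cases "a \<in> A") (simp_all add: PiE_arb[OF that])
    qed
  qed
  then show ?thesis
    using bij_betw_same_card[of _ _ "PiE A Q"] by (simp add: card_PiE[OF assms(1)])
qed

lemma card_A_graphs:
  assumes "finite A" "finite V"
  shows "card (A_graphs A V) = card (partial_injections V) ^ card A"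
proof -
  have "A_graphs A V = {E \<in> A_graphs A V. \<forall>a\<in>A. slice E a \<in> partial_injections V}"
    using assms by (auto simp: A_graphs_def A_graph_iff_slices)
  then show ?thesis
    using card_A_graphs_slices[OF assms, of "\<lambda>_. partial_injections V"] by simp
qed

lemma card_A_graph:
  assumes "finite A" "A_graph A V E"
  shows "card E = (\<Sum>a\<in>A. card (slice E a))"
proof -
  have fin: "finite E"
    using A_graph_finite[OF assms(2)] A_graph_subset[OF assms(2)] assms(1) by (meson finite_SigmaI finite_subset)
  have "E = (\<Union>a\<in>A. (\<lambda>(u, v). (u, a, v)) ` slice E a)"
    using A_graph_subset[OF assms(2)] by (force simp: slice_def)
  then have "card E = card (\<Union>a\<in>A. (\<lambda>(u, v). (u, a, v)) ` slice E a)"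
    by simp
  also have "\<dots> = (\<Sum>a\<in>A. card ((\<lambda>(u, v). (u, a, v)) ` slice E a))"
  proof (rule card_UN_disjoint)
    have "finite (slice E a)" for a
      using finite_vimageI[OF fin, of "\<lambda>(u, v). (u, a, v)"]
      by (simp add: slice_def vimage_def inj_on_def split_def)
    then show "\<forall>a\<in>A. finite ((\<lambda>(u, v). (u, a, v)) ` slice E a)"
      by blast
  qed (use assms in auto)
  also have "\<dots> = (\<Sum>a\<in>A. card (slice E a))"
    by (intro sum.cong card_image) (auto simp: inj_on_def)
  finally show ?thesis .
qed

lemma sum_A_graphs_slice:
  fixes g :: "('v \<times> 'v) set \<Rightarrow> real"
  assumes "finite A" "finite V" "a \<in> A"
  shows "(\<Sum>E\<in>A_graphs A V. g (slice E a)) =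
         real (card (partial_injections V)) ^ (card A - 1) * (\<Sum>R\<in>partial_injections V. g R)"
proof -
  let ?P = "partial_injections V"
  have "(\<lambda>E. slice E a) ` A_graphs A V \<subseteq> ?P"
    using assms by (auto simp: A_graphs_def A_graph_iff_slices)
  then have "(\<Sum>E\<in>A_graphs A V. g (slice E a)) =
             (\<Sum>R\<in>?P. \<Sum>E\<in>{E \<in> A_graphs A V. slice E a = R}. g (slice E a))"
    using assms by (subst sum.group) (auto simp: finite_A_graphs)
  also have "\<dots> = (\<Sum>R\<in>?P. real (card ?P) ^ (card A - 1) * g R)"
  proof (rule sum.cong)
    fix R assume R: "R \<in> ?P"
    have "{E \<in> A_graphs A V. slice E a = R} =
          {E \<in> A_graphs A V. \<forall>b\<in>A. slice E b \<in> (if b = a then {R} else ?P)}"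
      using assms by (auto simp: A_graphs_def A_graph_iff_slices)
    also have "card \<dots> = (\<Prod>b\<in>A. card (if b = a then {R} else ?P))"
      using R assms by (intro card_A_graphs_slices) auto
    also have "\<dots> = card ?P ^ (card A - 1)"
      using assms by (simp add: prod.remove[of A a] card_Diff_singleton)
    finally show "(\<Sum>E\<in>{E \<in> A_graphs A V. slice E a = R}. g (slice E a)) =
                  real (card ?P) ^ (card A - 1) * g R"
      by simp
  qed simp
  finally show ?thesis
    by (simp add: sum_distrib_left)
qed

lemma second_moment_A_graphs:
  assumes A: "finite A" and V: "finite V"
  shows "(\<Sum>E\<in>A_graphs A V.
            (real (card A) * (real (card V) - sqrt (real (card V))) - real (card E))\<^sup>2) \<le>
         real (card (A_graphs A V)) * ((real (card A))\<^sup>2 * (sqrt (real (card V)) + 1))"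
proof (cases "A = {}")
  case True
  have "A_graphs A V = {{}}"
    using V True by (auto simp: A_graphs_def intro!: A_graphI dest: A_graph_subset)
  with True show ?thesis by simp
next
  case False
  let ?G = "A_graphs A V" and ?P = "partial_injections V" and ?r = "real (card A)"
  let ?x = "\<lambda>R. real (card V) - real (card R) - sqrt (real (card V))"
  have "(?r * (real (card V) - sqrt (real (card V))) - real (card E))\<^sup>2 \<le>
        ?r * (\<Sum>a\<in>A. (?x (slice E a))\<^sup>2)" if "E \<in> ?G" for E
  proof -
    have "?r * (real (card V) - sqrt (real (card V))) - real (card E) = (\<Sum>a\<in>A. ?x (slice E a))"
      using that card_A_graph[OF A, of V E]
      by (simp add: A_graphs_def sum_subtractf sum.distrib algebra_simps)
    then show ?thesis
      using sum_squared_le_sum_of_squares[of "\<lambda>a. ?x (slice E a)"] False A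
      by (simp add: mult.commute)
  qed
  then have "(\<Sum>E\<in>?G. (?r * (real (card V) - sqrt (real (card V))) - real (card E))\<^sup>2) \<le>
        (\<Sum>E\<in>?G. ?r * (\<Sum>a\<in>A. (?x (slice E a))\<^sup>2))"
    by (rule sum_mono)
  also have "\<dots> = ?r * (\<Sum>a\<in>A. \<Sum>E\<in>?G. (?x (slice E a))\<^sup>2)"
    by (subst sum.swap) (simp only: sum_distrib_left)
  also have "\<dots> = ?r * (\<Sum>a\<in>A. real (card ?P) ^ (card A - 1) * (\<Sum>R\<in>?P. (?x R)\<^sup>2))"
    by (intro arg_cong2[where f = times] sum.cong refl sum_A_graphs_slice[OF A V])
  also have "\<dots> \<le> ?r * (\<Sum>a\<in>A. real (card ?P) ^ (card A - 1) *
      (real (card ?P) * (sqrt (real (card V)) + 1)))"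
    by (intro sum_mono mult_left_mono second_moment_partial_injections V) simp_all
  also have "\<dots> = ?r * (?r * (real (card ?G) * (sqrt (real (card V)) + 1)))"
  proof -
    have "real (card ?G) = real (card ?P) ^ (card A - 1) * real (card ?P)"
      using False A power_minus_mult[of "card A" "real (card ?P)"]
      by (simp add: card_A_graphs[OF A V] card_gt_0_iff)
    then show ?thesis
      by simp
  qed
  finally show ?thesis
    by (simp add: power2_eq_square mult_ac)
qed

text \<open>
  Among the two occurrences per letter that are possible at \<open>w\<close>, a leaf has at most one. So some
  letter misses \<open>w\<close> at one end at least, and every other letter misses it at both ends.
\<close>

lemma leaf_slices:
  assumes E: "A_graph A V E" and A: "finite A" "A \<noteq> {}" and w: "w \<in> V" "is_leaf E w"
  shows "\<exists>a\<in>A. (w \<notin> Domain (slice E a) \<or> w \<notin> Range (slice E a)) \<and>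
           (\<forall>b\<in>A - {a}. slice E b \<in> partial_injections (V - {w}))"
proof -
  have fin: "finite E"
    using A_graph_finite[OF E] A_graph_subset[OF E] A by (meson finite_SigmaI finite_subset)
  let ?out = "{(u, a, v). (u, a, v) \<in> E \<and> u = w}" and ?in = "{(u, a, v). (u, a, v) \<in> E \<and> v = w}"
  have fin: "finite ?out" "finite ?in"
    by (rule finite_subset[OF _ fin]; auto)+
  have le: "card ?out + card ?in \<le> 1"
    using w by (simp add: is_leaf_def occurrences_def)
  have PI: "slice E b \<in> partial_injections (V - {w})"
    if "w \<notin> Domain (slice E b)" "w \<notin> Range (slice E b)" "b \<in> A" for b
  proof -
    have "slice E b \<in> partial_injections V"
      using E that A_graph_iff_slices[OF A_graph_finite[OF E], of A E] by simp
    with that show ?thesis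
      by (auto simp: partial_injections_def)
  qed
  consider "?out = {}" "?in = {}" | e where "?out = {e}" "?in = {}" | e where "?out = {}" "?in = {e}"
  proof -
    have "card ?out = 0 \<and> card ?in = 0 \<or> card ?out = 1 \<and> card ?in = 0 \<or> card ?out = 0 \<and> card ?in = 1"
      using le by linarith
    then show ?thesis
      using that fin by (auto simp: card_1_singleton_iff simp del: Collect_empty_eq)
  qed
  then show ?thesis
  proof cases
    case 1
    obtain a where "a \<in> A" using A by auto
    with 1 show ?thesis
      by (intro bexI[of _ a] conjI ballI PI) (auto simp: slice_def)
  next
    case 2
    then have "e \<in> ?out" by simp
    then obtain a x where e: "e = (w, a, x)" by auto
    have "e \<in> ?out" unfolding 2 by simp
    then have "(w, a, x) \<in> E" using e by simp
    then have "a \<in> A" using A_graph_subset[OF E] by auto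
    moreover have "w \<notin> Range (slice E b)" for b
      using 2 by (auto simp: slice_def)
    moreover have "w \<notin> Domain (slice E b)" if "b \<noteq> a" for b
    proof
      assume "w \<in> Domain (slice E b)"
      then obtain y where "(w, b, y) \<in> ?out" by (auto simp: slice_def)
      then have "(w, b, y) = e" using 2 by auto
      then show False using e that by simp
    qed
    ultimately show ?thesis
      by (intro bexI[of _ a] conjI ballI PI) auto
  next
    case 3
    then have "e \<in> ?in" by simp
    then obtain a x where e: "e = (x, a, w)" by auto
    have "e \<in> ?in" unfolding 3 by simp
    then have "(x, a, w) \<in> E" using e by simp
    then have "a \<in> A" using A_graph_subset[OF E] by auto
    moreover have "w \<notin> Domain (slice E b)" for b
      using 3 by (auto simp: slice_def)
    moreover have "w \<notin> Range (slice E b)" if "b \<noteq> a" for b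
    proof
      assume "w \<in> Range (slice E b)"
      then obtain y where "(y, b, w) \<in> ?in" by (auto simp: slice_def)
      then have "(y, b, w) = e" using 3 by auto
      then show False using e that by simp
    qed
    ultimately show ?thesis
      by (intro bexI[of _ a] conjI ballI PI) auto
  qed
qed

text \<open>
  Being missed at both ends has probability at most \<open>1 / n\<close>, and being missed at one given end has
  probability at most \<open>1 / sqrt n\<close> on average over the vertices. With at least two letters the
  expected number of leaves is therefore at most of order \<open>n * (1 / n) * (1 / sqrt n)\<close>.
\<close>

lemma card_A_graphs_leaf_le:
  assumes A: "finite A" "card A \<ge> 2" and V: "finite V" "V \<noteq> {}"
  shows "real (card {E \<in> A_graphs A V. \<exists>w\<in>V. is_leaf E w}) \<le>
         real (card (A_graphs A V)) * (2 * real (card A) / sqrt (real (card V)))"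
proof -
  let ?G = "A_graphs A V" and ?P = "partial_injections V"
  let ?n = "real (card V)" and ?N = "real (card (partial_injections V))" and ?r = "card A"
  have n: "?n \<ge> 1"
    using V by (simp add: Suc_leI card_gt_0_iff)
  \<comment> \<open>\<open>Q w\<close>: condition on the letter that misses \<open>w\<close> at one end; \<open>B w a\<close>: \<open>a\<close> is that letter\<close>
  define Q where "Q w = {R \<in> ?P. w \<notin> Domain R \<or> w \<notin> Range R}" for w
  define B where "B w a = {E \<in> ?G. \<forall>b\<in>A. slice E b \<in>
      (if b = a then Q w else partial_injections (V - {w}))}" for w a
  have "{E \<in> ?G. \<exists>w\<in>V. is_leaf E w} \<subseteq> (\<Union>w\<in>V. \<Union>a\<in>A. B w a)"
  proof
    fix E assume "E \<in> {E \<in> ?G. \<exists>w\<in>V. is_leaf E w}"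
    then obtain w where E: "E \<in> ?G" "A_graph A V E" and w: "w \<in> V" "is_leaf E w"
      by (auto simp: A_graphs_def)
    have "A \<noteq> {}" using A by auto
    from leaf_slices[OF E(2) A(1) this w] obtain a where
      a: "a \<in> A" "w \<notin> Domain (slice E a) \<or> w \<notin> Range (slice E a)"
      "\<forall>b\<in>A - {a}. slice E b \<in> partial_injections (V - {w})"
      by auto
    then have "E \<in> B w a"
      using E V by (auto simp: B_def Q_def A_graph_iff_slices)
    with a w show "E \<in> (\<Union>w\<in>V. \<Union>a\<in>A. B w a)" by blast
  qed
  then have "card {E \<in> ?G. \<exists>w\<in>V. is_leaf E w} \<le> card (\<Union>w\<in>V. \<Union>a\<in>A. B w a)"
    using A V by (intro card_mono) (auto simp: B_def finite_A_graphs)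
  also have "\<dots> \<le> (\<Sum>w\<in>V. \<Sum>a\<in>A. card (B w a))"
    by (intro order_trans[OF card_UN_le] sum_mono card_UN_le A V)
  finally have "real (card {E \<in> ?G. \<exists>w\<in>V. is_leaf E w}) \<le> (\<Sum>w\<in>V. \<Sum>a\<in>A. real (card (B w a)))"
    by (metis (mono_tags, lifting) of_nat_le_iff of_nat_sum sum.cong)
  also have "\<dots> \<le> (\<Sum>w\<in>V. \<Sum>a\<in>A. real (card (Q w)) * (?N / ?n) ^ (?r - 1))"
  proof (intro sum_mono)
    fix w a assume w: "w \<in> V" and a: "a \<in> A"
    have "partial_injections (V - {w}) \<subseteq> ?P"
      by (auto simp: partial_injections_def)
    then have "card (B w a) = (\<Prod>b\<in>A. card (if b = a then Q w else partial_injections (V - {w})))"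
      unfolding B_def using A V by (intro card_A_graphs_slices) (auto simp: Q_def)
    also have "\<dots> = card (Q w) * card (partial_injections (V - {w})) ^ (?r - 1)"
      using A a by (simp add: prod.remove[of A a] card_Diff_singleton)
    finally have "real (card (B w a)) = real (card (Q w)) * real (card (partial_injections (V - {w}))) ^ (?r - 1)"
      by simp
    also have "\<dots> \<le> real (card (Q w)) * (?N / ?n) ^ (?r - 1)"
      using card_partial_injections_Diff_le[OF V(1) w] n
      by (intro mult_left_mono power_mono) (auto simp: field_simps)
    finally show "real (card (B w a)) \<le> real (card (Q w)) * (?N / ?n) ^ (?r - 1)" .
  qed
  also have "\<dots> = real ?r * (?N / ?n) ^ (?r - 1) * (\<Sum>w\<in>V. real (card (Q w)))"
    by (simp add: mult_ac flip: sum_distrib_left sum_distrib_right)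
  also have "\<dots> \<le> real ?r * (?N * ?N ^ (?r - 2) / ?n) * (2 * (?N * sqrt ?n))"
  proof (intro mult_mono mult_left_mono)
    have N: "?r - 1 = Suc (?r - 2)" using A by simp
    show "(?N / ?n) ^ (?r - 1) \<le> ?N * ?N ^ (?r - 2) / ?n"
    proof -
      have "?N / ?n \<le> ?N" using n by (simp add: divide_le_eq mult_le_cancel_left1)
      then have "(?N / ?n) ^ (?r - 2) \<le> ?N ^ (?r - 2)"
        by (intro power_mono) auto
      then have "?N / ?n * (?N / ?n) ^ (?r - 2) \<le> ?N / ?n * ?N ^ (?r - 2)"
        by (intro mult_left_mono) auto
      then show ?thesis unfolding N by simp
    qed
    have "(\<Sum>w\<in>V. real (card (Q w))) = (\<Sum>w\<in>V. \<Sum>R\<in>?P. of_bool (w \<notin> Domain R \<or> w \<notin> Range R))"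
      using V by (simp add: Q_def Int_def)
    also have "\<dots> \<le> (\<Sum>w\<in>V. \<Sum>R\<in>?P. of_bool (w \<notin> Domain R) + of_bool (w \<notin> Range R))"
      by (intro sum_mono) auto
    also have "\<dots> = (\<Sum>R\<in>?P. (\<Sum>w\<in>V. of_bool (w \<notin> Domain R)) + (\<Sum>w\<in>V. of_bool (w \<notin> Range R)))"
      by (subst sum.swap) (simp only: sum.distrib)
    also have "\<dots> = (\<Sum>R\<in>?P. 2 * (?n - real (card R)))"
    proof (rule sum.cong)
      fix R assume R: "R \<in> ?P"
      have "(\<Sum>w\<in>V. of_bool (w \<notin> X)) = real (card (V - X))" for X
        using V by (simp add: Int_def set_diff_eq)
      then show "(\<Sum>w\<in>V. of_bool (w \<notin> Domain R)) + (\<Sum>w\<in>V. of_bool (w \<notin> Range R)) =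
                 2 * (?n - real (card R))"
        using card_undefined_partial_injection[OF V(1) R] card_partial_injection_le[OF V(1) R]
        by simp
    qed simp
    also have "\<dots> \<le> 2 * (?N * sqrt ?n)"
      using sum_undefined_partial_injections_le[OF V(1)] by (subst sum_distrib_left[symmetric]) simp
    finally show "(\<Sum>w\<in>V. real (card (Q w))) \<le> 2 * (?N * sqrt ?n)" .
  qed (auto intro: sum_nonneg)
  also have "\<dots> = (?N * ?N * ?N ^ (?r - 2)) * (2 * real ?r * (sqrt ?n / ?n))"
    by simp
  also have "?N * ?N * ?N ^ (?r - 2) = real (card ?G)"
  proof -
    have "?r = Suc (Suc (?r - 2))" using A by simp
    then have "?N ^ ?r = ?N * (?N * ?N ^ (?r - 2))" by (metis power_Suc)
    then show ?thesis by (simp add: card_A_graphs[OF A(1) V(1)])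
  qed
  also have "sqrt ?n / ?n = 1 / sqrt ?n"
    using n by (simp add: field_simps)
  finally show ?thesis by simp
qed

section \<open>Most graphs are connected\<close>

lemma card_splitting_partial_injections_le:
  assumes V: "finite V" and S: "S \<subseteq> V"
  shows "card {R \<in> partial_injections V. R \<subseteq> S \<times> S \<union> (V - S) \<times> (V - S)} \<le>
         card (partial_injections S) * card (partial_injections (V - S))"
proof -
  let ?B = "{R \<in> partial_injections V. R \<subseteq> S \<times> S \<union> (V - S) \<times> (V - S)}"
  let ?f = "\<lambda>R. (R \<inter> S \<times> S, R \<inter> (V - S) \<times> (V - S))"
  have "inj_on ?f ?B"
    by (rule inj_onI) blast
  moreover have "?f ` ?B \<subseteq> partial_injections S \<times> partial_injections (V - S)"
    by (auto simp: partial_injections_def single_valued_def)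
  moreover have "finite (partial_injections S \<times> partial_injections (V - S))"
    using V finite_subset[OF S V] by simp
  ultimately have "card ?B \<le> card (partial_injections S \<times> partial_injections (V - S))"
    by (rule card_inj_on_le)
  then show ?thesis
    by (simp add: card_cartesian_product)
qed

text \<open>
  Writing the three numbers of partial injections as factorials times \<^const>\<open>laguerre\<close>, the factorials
  combine to a binomial coefficient, and the Laguerre value of \<open>V - S\<close> is at most that of \<open>V\<close>.
\<close>

lemma partial_injections_split_ratio:
  assumes V: "finite V" and S: "S \<subseteq> V"
  shows "real (card (partial_injections S)) * real (card (partial_injections (V - S))) \<le>
         real (card (partial_injections V)) * (laguerre (card S) / real (card V choose card S))"
proof -
  let ?n = "card V" and ?k = "card S"
  have k: "?k \<le> ?n" using V S by (rule card_mono)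
  have fin: "finite S" using V S by (rule finite_subset[rotated])
  have "card (V - S) = ?n - ?k"
    using S fin by (simp add: card_Diff_subset)
  then have "real (card (partial_injections S)) * real (card (partial_injections (V - S))) =
      fact ?k * fact (?n - ?k) * laguerre ?k * laguerre (?n - ?k)"
    using fin V by (simp add: card_partial_injections)
  also have "\<dots> \<le> fact ?k * fact (?n - ?k) * laguerre ?k * laguerre ?n"
    using laguerre_ge_1[of ?k] by (intro mult_left_mono laguerre_mono) auto
  also have "fact ?k * fact (?n - ?k) = (fact ?n / real (?n choose ?k) :: real)"
    using k by (simp add: binomial_fact)
  finally show ?thesis
    using V by (simp add: card_partial_injections mult_ac)
qed

text \<open>
  Take for \<open>S\<close> a connected component or its complement, whichever is smaller.
\<close>

lemma disconnected_slices:
  assumes E: "A_graph A V E" and dis: "\<not> graph_connected V E"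
  shows "\<exists>S\<subseteq>V. S \<noteq> {} \<and> 2 * card S \<le> card V \<and>
           (\<forall>a. slice E a \<subseteq> S \<times> S \<union> (V - S) \<times> (V - S))"
proof -
  let ?r = "{(x, y). \<exists>a. (x, a, y) \<in> E \<or> (y, a, x) \<in> E}"
  obtain u v where uv: "u \<in> V" "v \<in> V" "(u, v) \<notin> ?r\<^sup>*"
    using dis by (auto simp: graph_connected_def)
  define C where "C = {x \<in> V. (u, x) \<in> ?r\<^sup>*}"
  have step: "y \<in> C" if "x \<in> C" "y \<in> V" "(x, y) \<in> ?r" for x y
    using that unfolding C_def by (auto intro: rtrancl_into_rtrancl)
  have split: "slice E a \<subseteq> C \<times> C \<union> (V - C) \<times> (V - C)" for a
  proof
    fix p assume "p \<in> slice E a"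
    then obtain x y where p: "p = (x, y)" "(x, a, y) \<in> E" by (auto simp: slice_def)
    then have "x \<in> V" "y \<in> V" "(x, y) \<in> ?r" "(y, x) \<in> ?r"
      using A_graph_subset[OF E] by auto
    then have "x \<in> C \<longleftrightarrow> y \<in> C"
      using step by blast
    with p \<open>x \<in> V\<close> \<open>y \<in> V\<close> show "p \<in> C \<times> C \<union> (V - C) \<times> (V - C)" by auto
  qed
  have C: "C \<subseteq> V" "u \<in> C" "v \<in> V - C"
    using uv by (auto simp: C_def)
  have "card C + card (V - C) = card V"
    using C A_graph_finite[OF E] by (metis card_Diff_subset card_mono finite_subset le_add_diff_inverse)
  then consider "2 * card C \<le> card V" | "2 * card (V - C) \<le> card V"
    by linarith
  then show ?thesis
  proof cases
    case 1
    with C split show ?thesis by (intro exI[of _ C]) auto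
  next
    case 2
    have "V - (V - C) = C" using C by auto
    with 2 C split show ?thesis by (intro exI[of _ "V - C"]) auto
  qed
qed

text \<open>
  The binomial coefficient is at least \<open>n\<close> and at least \<open>2 ^ k\<close>, hence at least the geometric mean
  of the two; \<open>7 / 5\<close> is a rational number just below the square root of 2.
\<close>

lemma binomial_ge_sqrt:
  assumes "1 \<le> k" "2 * k \<le> n"
  shows "sqrt (real n) * (7 / 5) ^ k \<le> real (n choose k)"
proof -
  have "n choose 1 \<le> n choose k"
    using assms by (intro binomial_mono) auto
  then have 1: "real n \<le> real (n choose k)" by simp
  have "2 \<le> real n / real k"
    using assms by (simp add: field_simps)
  then have "2 ^ k \<le> (real n / real k) ^ k"
    by (intro power_mono) auto
  also have "\<dots> \<le> real (n choose k)"
    using assms by (intro binomial_ge_n_over_k_pow_k) auto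
  finally have 2: "2 ^ k \<le> real (n choose k)" .
  have "((7 / 5) ^ k)\<^sup>2 = (49 / 25 :: real) ^ k"
    by (simp add: power2_eq_square flip: power_mult_distrib)
  also have "\<dots> \<le> 2 ^ k"
    by (intro power_mono) auto
  also note 2
  finally have "real n * ((7 / 5) ^ k)\<^sup>2 \<le> real (n choose k) * real (n choose k)"
    using 1 by (intro mult_mono) auto
  then have "(sqrt (real n) * (7 / 5) ^ k)\<^sup>2 \<le> (real (n choose k))\<^sup>2"
    by (simp add: power_mult_distrib power2_eq_square[of "real (n choose k)"])
  then show ?thesis
    by (rule power2_le_imp_le) simp
qed

text \<open>
  The numerator grows like \<open>(9 / 8) ^ (2 * k)\<close> at most, more slowly than the \<open>(7 / 5) ^ k\<close> in the
  denominator, so a geometric series with ratio \<open>405 / 448\<close> remains; its sum is less than 11.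
\<close>

lemma sum_laguerre_binomial_le:
  shows "(\<Sum>k\<in>{k. 1 \<le> k \<and> 2 * k \<le> n}. (laguerre k)\<^sup>2 / real (n choose k)) \<le>
         11 * exp 16 / sqrt (real n)"
proof -
  let ?K = "{k. 1 \<le> k \<and> 2 * k \<le> n}" and ?q = "405 / 448 :: real"
  have "(laguerre k)\<^sup>2 / real (n choose k) \<le> exp 16 / sqrt (real n) * ?q ^ k" if "k \<in> ?K" for k
  proof -
    have "laguerre k \<le> exp 8 * (9 / 8) ^ k"
      using laguerre_le[of "1 / 8" k] by simp
    then have "(laguerre k)\<^sup>2 \<le> (exp 8 * (9 / 8) ^ k)\<^sup>2"
      using laguerre_ge_1[of k] by (intro power_mono) auto
    also have "\<dots> = exp 16 * (81 / 64) ^ k"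
      by (simp add: power2_eq_square mult_ac flip: exp_add power_mult_distrib)
    finally have "(laguerre k)\<^sup>2 / real (n choose k) \<le>
        (exp 16 * (81 / 64) ^ k) / (sqrt (real n) * (7 / 5) ^ k)"
      using binomial_ge_sqrt[of k n] that by (intro frac_le) auto
    also have "\<dots> = exp 16 / sqrt (real n) * ((81 / 64) / (7 / 5)) ^ k"
      by (simp only: power_divide times_divide_times_eq)
    finally show ?thesis by simp
  qed
  then have "(\<Sum>k\<in>?K. (laguerre k)\<^sup>2 / real (n choose k)) \<le>
      (\<Sum>k\<in>?K. exp 16 / sqrt (real n) * ?q ^ k)"
    by (rule sum_mono)
  also have "\<dots> = exp 16 / sqrt (real n) * (\<Sum>k\<in>?K. ?q ^ k)"
    by (simp only: sum_distrib_left)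
  also have "(\<Sum>k\<in>?K. ?q ^ k) \<le> (\<Sum>k. ?q ^ k)"
    by (intro sum_le_suminf summable_geometric) (auto intro: finite_subset[of _ "{..n}"])
  also have "\<dots> \<le> 11"
    by (subst suminf_geometric) auto
  finally show ?thesis
    by (simp add: mult_left_mono divide_right_mono field_simps)
qed

text \<open>
  Union bound over the sets \<open>S\<close> that no edge leaves. Each letter contributes a factor \<open>L / C\<close>, where
  \<open>L\<close> is the Laguerre value at the size of \<open>S\<close> and \<open>C\<close> the number of sets of that size; two letters
  already give \<open>L\<^sup>2 / C\<^sup>2\<close>, and summation over the \<open>C\<close> sets leaves \<open>L\<^sup>2 / C\<close>.
\<close>

lemma card_A_graphs_disconnected_le:
  assumes A: "finite A" "card A \<ge> 2" and V: "finite V"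
  shows "real (card {E \<in> A_graphs A V. \<not> graph_connected V E}) \<le>
         real (card (A_graphs A V)) * (11 * exp 16 / sqrt (real (card V)))"
proof -
  let ?G = "A_graphs A V" and ?P = "partial_injections V"
  let ?n = "card V" and ?N = "real (card (partial_injections V))" and ?r = "card A"
  define Q where "Q S = {R \<in> ?P. R \<subseteq> S \<times> S \<union> (V - S) \<times> (V - S)}" for S
  define B where "B S = {E \<in> ?G. \<forall>a\<in>A. slice E a \<in> Q S}" for S
  define F where "F = {S. S \<subseteq> V \<and> S \<noteq> {} \<and> 2 * card S \<le> ?n}"
  have finF: "finite F"
    unfolding F_def by (rule finite_subset[of _ "Pow V"]) (use V in auto)
  have "{E \<in> ?G. \<not> graph_connected V E} \<subseteq> (\<Union>S\<in>F. B S)"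
  proof
    fix E assume "E \<in> {E \<in> ?G. \<not> graph_connected V E}"
    then have E: "E \<in> ?G" "A_graph A V E" "\<not> graph_connected V E"
      by (auto simp: A_graphs_def)
    then obtain S where "S \<in> F" "\<forall>a. slice E a \<subseteq> S \<times> S \<union> (V - S) \<times> (V - S)"
      using disconnected_slices[OF E(2,3)] by (auto simp: F_def)
    moreover have "slice E a \<in> ?P" if "a \<in> A" for a
      using E that V by (auto simp: A_graph_iff_slices)
    ultimately show "E \<in> (\<Union>S\<in>F. B S)"
      using E by (auto simp: B_def Q_def)
  qed
  then have "card {E \<in> ?G. \<not> graph_connected V E} \<le> card (\<Union>S\<in>F. B S)"
    using A V finF by (intro card_mono) (auto simp: B_def finite_A_graphs)
  also have "\<dots> \<le> (\<Sum>S\<in>F. card (B S))"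
    by (rule card_UN_le[OF finF])
  finally have "real (card {E \<in> ?G. \<not> graph_connected V E}) \<le> (\<Sum>S\<in>F. real (card (B S)))"
    by (metis (mono_tags, lifting) of_nat_le_iff of_nat_sum sum.cong)
  also have "\<dots> \<le> (\<Sum>S\<in>F. ?N ^ ?r * (laguerre (card S) / real (?n choose card S))\<^sup>2)"
  proof (rule sum_mono)
    fix S assume "S \<in> F"
    then have S: "S \<subseteq> V" by (simp add: F_def)
    obtain m where m: "?r = 2 + m" using A le_Suc_ex by blast
    have "card (B S) = card (Q S) ^ ?r"
      unfolding B_def using A V by (subst card_A_graphs_slices) (auto simp: Q_def)
    also have "\<dots> = card (Q S) ^ 2 * card (Q S) ^ m"
      by (simp only: m power_add)
    finally have "real (card (B S)) = real (card (Q S)) ^ 2 * real (card (Q S)) ^ m"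
      by simp
    also have "\<dots> \<le> (?N * (laguerre (card S) / real (?n choose card S))) ^ 2 * ?N ^ m"
    proof (intro mult_mono power_mono)
      have "real (card (Q S)) \<le> real (card (partial_injections S)) * real (card (partial_injections (V - S)))"
        using card_splitting_partial_injections_le[OF V S] unfolding Q_def
        by (simp only: of_nat_mult[symmetric] of_nat_le_iff)
      also have "\<dots> \<le> ?N * (laguerre (card S) / real (?n choose card S))"
        by (rule partial_injections_split_ratio[OF V S])
      finally show "real (card (Q S)) \<le> ?N * (laguerre (card S) / real (?n choose card S))" .
      show "real (card (Q S)) \<le> ?N"
        using V by (auto simp: Q_def intro!: card_mono)
    qed auto
    also have "\<dots> = ?N ^ ?r * (laguerre (card S) / real (?n choose card S))\<^sup>2"
    proof -
      have "?N ^ ?r = ?N ^ 2 * ?N ^ m"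
        by (simp only: m power_add)
      then show ?thesis by (simp add: power_mult_distrib power_divide)
    qed
    finally show "real (card (B S)) \<le> ?N ^ ?r * (laguerre (card S) / real (?n choose card S))\<^sup>2" .
  qed
  also have "\<dots> = ?N ^ ?r * (\<Sum>S\<in>F. (laguerre (card S) / real (?n choose card S))\<^sup>2)"
    by (simp only: sum_distrib_left)
  also have "(\<Sum>S\<in>F. (laguerre (card S) / real (?n choose card S))\<^sup>2) =
      (\<Sum>k\<in>{k. 1 \<le> k \<and> 2 * k \<le> ?n}. \<Sum>S\<in>{S \<in> F. card S = k}. (laguerre (card S) / real (?n choose card S))\<^sup>2)"
  proof (rule sum.group[symmetric, OF finF])
    show "finite {k. 1 \<le> k \<and> 2 * k \<le> ?n}"
      by (rule finite_subset[of _ "{..?n}"]) auto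
    show "card ` F \<subseteq> {k. 1 \<le> k \<and> 2 * k \<le> ?n}"
      using finite_subset[OF _ V] by (auto simp: F_def Suc_le_eq card_gt_0_iff)
  qed
  also have "\<dots> = (\<Sum>k\<in>{k. 1 \<le> k \<and> 2 * k \<le> ?n}. (laguerre k)\<^sup>2 / real (?n choose k))"
  proof (rule sum.cong)
    fix k assume k: "k \<in> {k. 1 \<le> k \<and> 2 * k \<le> ?n}"
    then have "{S \<in> F. card S = k} = {S. S \<subseteq> V \<and> card S = k}"
      by (auto simp: F_def)
    then have "card {S \<in> F. card S = k} = ?n choose k"
      using n_subsets[OF V] by simp
    moreover have "real (?n choose k) > 0" using k by simp
    ultimately show "(\<Sum>S\<in>{S \<in> F. card S = k}. (laguerre (card S) / real (?n choose card S))\<^sup>2) =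
        (laguerre k)\<^sup>2 / real (?n choose k)"
      by (simp add: power2_eq_square)
  qed simp
  also have "\<dots> \<le> 11 * exp 16 / sqrt (real ?n)"
    by (rule sum_laguerre_binomial_le)
  finally show ?thesis
    by (simp add: card_A_graphs[OF A(1) V] mult_left_mono)
qed

text \<open>
  The proportion in fact tends to 1; one half is enough to transfer second moments.
\<close>

lemma eventually_half_admissible:
  assumes A: "finite A" "card A \<ge> 2"
  shows "\<forall>\<^sub>F n in sequentially. \<forall>V (v :: 'v). finite V \<longrightarrow> card V = n \<longrightarrow> v \<in> V \<longrightarrow>
           real (card (A_graphs A V)) \<le> 2 * real (card {E. admissible A V E v})"
proof -
  define C where "C = 2 * real (card A) + 11 * exp 16"
  have "\<forall>\<^sub>F n in sequentially. C / sqrt (real n) \<le> 1 / 2"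
    by real_asymp
  then show ?thesis
  proof (eventually_elim, intro allI impI)
    fix n V and v :: 'v
    assume n: "C / sqrt (real n) \<le> 1 / 2" and V: "finite V" "card V = n" "v \<in> V"
    let ?G = "A_graphs A V"
    let ?L = "{E \<in> ?G. \<exists>w\<in>V. is_leaf E w}" and ?D = "{E \<in> ?G. \<not> graph_connected V E}"
    have "?G \<subseteq> {E. admissible A V E v} \<union> (?L \<union> ?D)"
      using V by (auto simp: A_graphs_def admissible_def trim_at_def)
    moreover have "{E. admissible A V E v} \<subseteq> ?G"
      by (auto simp: A_graphs_def admissible_def)
    ultimately have "card ?G \<le> card ({E. admissible A V E v} \<union> (?L \<union> ?D))"
      using finite_A_graphs[OF A(1) V(1)] by (intro card_mono) (auto intro: finite_subset)
    also have "\<dots> \<le> card {E. admissible A V E v} + (card ?L + card ?D)"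
      using card_Un_le[of "{E. admissible A V E v}" "?L \<union> ?D"] card_Un_le[of ?L ?D] by linarith
    finally have "real (card ?G) \<le> real (card {E. admissible A V E v}) + (real (card ?L) + real (card ?D))"
      by linarith
    also have "real (card ?L) + real (card ?D) \<le> real (card ?G) * (C / sqrt (real n))"
    proof -
      have "V \<noteq> {}" using V by auto
      from card_A_graphs_leaf_le[OF A V(1) this] card_A_graphs_disconnected_le[OF A V(1)] show ?thesis
        by (simp add: C_def V(2) add_divide_distrib distrib_left)
    qed
    also have "\<dots> \<le> real (card ?G) * (1 / 2)"
      using n by (intro mult_left_mono) auto
    finally show "real (card ?G) \<le> 2 * real (card {E. admissible A V E v})"
      by simp
  qed
qed

section \<open>Walks, and uniqueness of the graphical representation\<close>

definition inv_word :: "'a letter list \<Rightarrow> 'a letter list" where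
  "inv_word w = rev (map inv_letter w)"

lemma inv_word_simps [simp]:
  "inv_word [] = []" "inv_word (x # w) = inv_word w @ [inv_letter x]"
  "inv_word (u @ w) = inv_word w @ inv_word u"
  by (simp_all add: inv_word_def)

lemma inv_word_inv_word [simp]: "inv_word (inv_word w) = w"
  by (simp add: inv_word_def rev_map o_def)

lemma reduce_cancel: "reduce (u @ inv_word w @ w @ v) = reduce (u @ v)"
proof -
  have "reduce (u @ (inv_word w @ w) @ v) = reduce (u @ reduce (reduce (inv_word w @ w) @ v))"
    by (metis reduce_reduce_left reduce_reduce_right)
  also have "\<dots> = reduce (u @ v)"
    by (simp add: inv_word_def reduce_inverse reduce_reduce_right)
  finally show ?thesis by simp
qed

lemma reduce_cancel': "reduce (u @ w @ inv_word w @ v) = reduce (u @ v)"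
  using reduce_cancel[of u "inv_word w" v] by simp

lemma reduce_cong: "reduce v = reduce v' \<Longrightarrow> reduce (u @ v @ w) = reduce (u @ v' @ w)"
  by (metis reduce_reduce_left reduce_reduce_right)

lemma reduced_inv_word: "reduced w \<Longrightarrow> reduced (inv_word w)"
  unfolding reduced_def inv_word_def
  by (auto simp: successively_map intro: successively_mono)

lemma reduced_append_iff:
  "reduced (u @ v) \<longleftrightarrow> reduced u \<and> reduced v \<and> (u \<noteq> [] \<longrightarrow> v \<noteq> [] \<longrightarrow> hd v \<noteq> inv_letter (last u))"
  by (auto simp: reduced_def successively_append_iff)

definition step :: "('v \<times> 'a \<times> 'v) set \<Rightarrow> 'v \<Rightarrow> 'a letter \<Rightarrow> 'v \<Rightarrow> bool" where
  "step E u x v \<longleftrightarrow> (if snd x then (u, fst x, v) \<in> E else (v, fst x, u) \<in> E)"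

lemma walk_Nil_iff [simp]: "walk E u [] v \<longleftrightarrow> u = v"
  by (auto elim: walk.cases intro: walk.nil)

lemma walk_Cons_iff: "walk E u (x # w) v \<longleftrightarrow> (\<exists>y. step E u x y \<and> walk E y w v)"
proof
  assume "walk E u (x # w) v"
  then show "\<exists>y. step E u x y \<and> walk E y w v"
    by cases (auto simp: step_def)
next
  assume "\<exists>y. step E u x y \<and> walk E y w v"
  then show "walk E u (x # w) v"
    by (cases x; cases "snd x") (auto simp: step_def intro: walk.forward walk.backward)
qed

lemma walk_append_iff: "walk E u (w @ w') v \<longleftrightarrow> (\<exists>y. walk E u w y \<and> walk E y w' v)"
  by (induction w arbitrary: u) (auto simp: walk_Cons_iff)

lemma walk_append: "walk E u w y \<Longrightarrow> walk E y w' v \<Longrightarrow> walk E u (w @ w') v"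
  by (auto simp: walk_append_iff)

lemma step_inv_letter: "step E u (inv_letter x) v \<longleftrightarrow> step E v x u"
  by (simp add: step_def inv_letter_def)

lemma walk_inv_word: "walk E u w v \<Longrightarrow> walk E v (inv_word w) u"
  by (induction w arbitrary: u) (auto simp: walk_Cons_iff walk_append_iff step_inv_letter)

lemma step_unique:
  assumes "A_graph A V E" "step E u x v" "step E u x v'"
  shows "v = v'"
  using assms A_graph_forward_unique[OF assms(1)] A_graph_backward_unique[OF assms(1)]
  by (auto simp: step_def split: if_splits)

lemma step_in: "A_graph A V E \<Longrightarrow> step E u x v \<Longrightarrow> u \<in> V \<and> v \<in> V \<and> x \<in> A \<times> UNIV"
  by (cases x) (auto simp: step_def dest!: A_graph_subset split: if_splits)

lemma walk_unique:
  assumes "A_graph A V E"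
  shows "walk E u w v \<Longrightarrow> walk E u w v' \<Longrightarrow> v = v'"
  by (induction w arbitrary: u) (auto simp: walk_Cons_iff dest: step_unique[OF assms])

lemma walk_in: "A_graph A V E \<Longrightarrow> u \<in> V \<Longrightarrow> walk E u w v \<Longrightarrow> v \<in> V"
  by (induction w arbitrary: u) (auto simp: walk_Cons_iff dest: step_in)

lemma walk_letters: "A_graph A V E \<Longrightarrow> walk E u w v \<Longrightarrow> set w \<subseteq> A \<times> UNIV"
  by (induction w arbitrary: u) (auto simp: walk_Cons_iff dest: step_in)

lemma walk_push:
  assumes E: "A_graph A V E" and w: "walk E u (x # w) v"
  shows "walk E u (push x w) v"
proof (cases w)
  case (Cons y w')
  show ?thesis
  proof (cases "y = inv_letter x")
    case True
    obtain z where z: "step E u x z" "walk E z w v"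
      using w by (auto simp: walk_Cons_iff)
    then obtain t where t: "step E z (inv_letter x) t" "walk E t w' v"
      using Cons True by (auto simp: walk_Cons_iff)
    then have "t = u"
      using z(1) step_unique[OF E t(1)] by (simp add: step_inv_letter)
    with t True Cons show ?thesis by simp
  qed (use w Cons in simp)
qed (use w in simp)

lemma walk_reduce:
  assumes E: "A_graph A V E"
  shows "walk E u w v \<Longrightarrow> walk E u (reduce w) v"
proof (induction w arbitrary: u)
  case (Cons x w)
  then obtain z where "step E u x z" "walk E z (reduce w) v"
    by (auto simp: walk_Cons_iff)
  then have "walk E u (x # reduce w) v"
    by (auto simp: walk_Cons_iff)
  from walk_push[OF E this] show ?case
    by (simp add: reduce_def)
qed (simp add: reduce_def)

lemma connected_walk:
  assumes "graph_connected V E" "u \<in> V" "v \<in> V"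
  shows "\<exists>w. walk E u w v"
proof -
  have "(u, v) \<in> {(x, y). \<exists>a. (x, a, y) \<in> E \<or> (y, a, x) \<in> E}\<^sup>*"
    using assms by (simp add: graph_connected_def)
  then show ?thesis
  proof (induction rule: rtrancl_induct)
    case base
    show ?case by (intro exI[of _ "[]"]) simp
  next
    case (step y z)
    then obtain w a where w: "walk E u w y" "(y, a, z) \<in> E \<or> (z, a, y) \<in> E" by auto
    then have "\<exists>b. step E y (a, b) z"
      unfolding step_def by (metis fst_conv snd_conv)
    then obtain b where "step E y (a, b) z" by blast
    with w show ?case
      by (intro exI[of _ "w @ [(a, b)]"]) (auto simp: walk_append_iff walk_Cons_iff)
  qed
qed

lemma connected_reduced_walk:
  assumes "A_graph A V E" "graph_connected V E" "u \<in> V" "v \<in> V"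
  shows "\<exists>w. reduced w \<and> walk E u w v"
  using connected_walk[OF assms(2-4)] walk_reduce[OF assms(1)] reduced_reduce by blast

lemma admissible_A_graph: "admissible A V E v \<Longrightarrow> A_graph A V E"
  by (simp add: admissible_def)

lemma non_leaf_extend:
  assumes E: "A_graph A V E" and leaf: "\<not> is_leaf E u"
  shows "\<exists>y z. y \<noteq> x \<and> step E u y z"
proof (rule ccontr)
  assume "\<nexists>y z. y \<noteq> x \<and> step E u y z"
  then have only: "y = x" if "step E u y z" for y z
    using that by blast
  have "card {(u', a, v). (u', a, v) \<in> E \<and> u' = u} + card {(u', a, v). (u', a, v) \<in> E \<and> v = u} \<le> 1"
    (is "card ?out + card ?in \<le> 1")
  proof (cases "snd x")
    case True
    have "card ?in = 0"
    proof (rule ccontr)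
      assume "card ?in \<noteq> 0"
      then have "?in \<noteq> {}" by (metis card.empty)
      then obtain a z where "(z, a, u) \<in> E" by auto
      then have "step E u (a, False) z" by (simp add: step_def)
      with only True show False by force
    qed
    moreover have "?out \<subseteq> {(u, fst x, THE z. step E u x z)}"
    proof
      fix e assume "e \<in> ?out"
      then obtain a z where e: "e = (u, a, z)" "(u, a, z) \<in> E" by auto
      then have "step E u (a, True) z" by (simp add: step_def)
      with only have x: "(a, True) = x" "step E u x z" by auto
      then have "(THE z. step E u x z) = z"
        using step_unique[OF E] by blast
      with x e show "e \<in> {(u, fst x, THE z. step E u x z)}" by auto
    qed
    then have "card ?out \<le> card {(u, fst x, THE z. step E u x z)}"
      by (intro card_mono) auto
    ultimately show ?thesis by (simp del: card_0_eq)
  next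
    case False
    have "card ?out = 0"
    proof (rule ccontr)
      assume "card ?out \<noteq> 0"
      then have "?out \<noteq> {}" by (metis card.empty)
      then obtain a z where "(u, a, z) \<in> E" by auto
      then have "step E u (a, True) z" by (simp add: step_def)
      with only False show False by force
    qed
    moreover have "?in \<subseteq> {(THE z. step E u x z, fst x, u)}"
    proof
      fix e assume "e \<in> ?in"
      then obtain a z where e: "e = (z, a, u)" "(z, a, u) \<in> E" by auto
      then have "step E u (a, False) z" by (simp add: step_def)
      with only have x: "(a, False) = x" "step E u x z" by auto
      then have "(THE z. step E u x z) = z"
        using step_unique[OF E] by blast
      with x e show "e \<in> {(THE z. step E u x z, fst x, u)}" by auto
    qed
    then have "card ?in \<le> card {(THE z. step E u x z, fst x, u)}"
      by (intro card_mono) auto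
    ultimately show ?thesis by (simp del: card_0_eq)
  qed
  then show False
    using leaf by (simp add: is_leaf_def occurrences_def)
qed

text \<open>
  A walk that is long enough revisits a vertex at positions \<open>i\<close> and \<open>i + m\<close> with \<open>m\<close> as large as prescribed. Move both positions
  backwards in parallel as long as the vertices agree. If this reaches the base point, the walk
  has closed up after \<open>m\<close> steps. Otherwise the two visits enter their common vertex along different
  edges, so the walk up to \<open>i + m\<close> can return along its own first \<open>i\<close> steps without backtracking.
\<close>

lemma reduced_walk_close:
  assumes E: "A_graph A V E"
    and z: "reduced z" "walk E v z u" "v \<in> V" and k: "1 \<le> k" "card V * k \<le> length z"
  shows "\<exists>m c. k \<le> m \<and> reduced (take m z @ c) \<and> walk E v (take m z @ c) v"
proof -
  define s where "s i = (THE y. walk E v (take i z) y)" for i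
  have s: "walk E v (take i z) (s i)" for i
  proof -
    obtain y where y: "walk E v (take i z) y"
      using z(2) walk_append_iff[of E v "take i z" "drop i z" u] by auto
    show ?thesis
      unfolding s_def by (rule theI[of "walk E v (take i z)", OF y]) (rule walk_unique[OF E _ y])
  qed
  have sV: "s i \<in> V" for i
    using walk_in[OF E z(3) s] .
  have "\<not> inj_on (\<lambda>i. s (i * k)) {..card V}"
  proof
    assume "inj_on (\<lambda>i. s (i * k)) {..card V}"
    moreover have "(\<lambda>i. s (i * k)) ` {..card V} \<subseteq> V"
      using sV by auto
    ultimately have "card {..card V} \<le> card V"
      using A_graph_finite[OF E] by (rule card_inj_on_le)
    then show False by simp
  qed
  then obtain i' j' where "i' \<le> card V" "j' \<le> card V" "i' \<noteq> j'" "s (i' * k) = s (j' * k)"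
    by (auto simp: inj_on_def)
  then obtain i j where ij: "i < j" "j \<le> card V" "s (i * k) = s (j * k)"
    by (cases i' j' rule: linorder_cases) auto
  define m where "m = (j - i) * k"
  have m: "k \<le> m" "i * k + m \<le> length z" "s (i * k) = s (i * k + m)"
  proof -
    have "i * k + m = j * k"
      using ij(1) by (simp add: m_def diff_mult_distrib)
    then show "i * k + m \<le> length z" "s (i * k) = s (i * k + m)"
      using ij(3) le_trans[OF mult_le_mono1[OF ij(2), of k] k(2)] by simp_all
    show "k \<le> m" using ij(1) by (cases "j - i") (auto simp: m_def)
  qed
  \<comment> \<open>the earliest position from which the walk is at the same vertex \<open>m\<close> steps later\<close>
  define i0 where "i0 = (LEAST i. s i = s (i + m) \<and> i + m \<le> length z)"
  have i0: "s i0 = s (i0 + m)" "i0 + m \<le> length z"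
    using LeastI[of "\<lambda>i. s i = s (i + m) \<and> i + m \<le> length z" "i * k"] m unfolding i0_def by auto
  have i0_min: "i0 \<le> i" if "s i = s (i + m)" "i + m \<le> length z" for i
    unfolding i0_def using that by (intro Least_le) simp
  show ?thesis
  proof (cases i0)
    case 0
    have "s 0 = v" using s[of 0] by simp
    with 0 i0 have "walk E v (take m z) v" using s[of m] by simp
    moreover have "reduced (take m z)"
      using z(1) reduced_append_iff[of "take m z" "drop m z"] by simp
    ultimately show ?thesis
      using m(1) by (intro exI[of _ m] exI[of _ "[]"]) simp
  next
    case (Suc p)
    let ?t = "take (i0 + m) z"
    have walk: "walk E v (?t @ inv_word (take i0 z)) v"
      using s[of "i0 + m"] walk_inv_word[OF s[of i0]] i0(1) by (metis walk_append)
    have lt: "p < length z" "p + m < length z"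
      using Suc i0(2) by auto
    have t1: "take i0 z = take p z @ [z ! p]" and t2: "?t = take (p + m) z @ [z ! (p + m)]"
      using Suc lt by (simp_all add: take_Suc_conv_app_nth)
    have ne: "z ! p \<noteq> z ! (p + m)"
    proof
      assume eq: "z ! p = z ! (p + m)"
      have st: "step E (s q) (z ! q) (s (Suc q))" if "q < length z" for q
      proof -
        have "take (Suc q) z = take q z @ [z ! q]"
          using that by (rule take_Suc_conv_app_nth)
        then obtain y where "walk E v (take q z) y" "step E y (z ! q) (s (Suc q))"
          using s[of "Suc q"] by (auto simp: walk_append_iff walk_Cons_iff)
        then show ?thesis using walk_unique[OF E s[of q]] by blast
      qed
      have "step E (s (Suc p)) (inv_letter (z ! p)) (s p)"
        using st[OF lt(1)] by (simp add: step_inv_letter)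
      moreover have "step E (s (Suc p)) (inv_letter (z ! p)) (s (p + m))"
        using st[OF lt(2)] i0(1) Suc eq by (simp add: step_inv_letter)
      ultimately have "s p = s (p + m)"
        by (rule step_unique[OF E])
      then have "i0 \<le> p" using lt by (intro i0_min) auto
      then show False using Suc by simp
    qed
    have red: "reduced ?t" "reduced (take i0 z)"
      using z(1) reduced_append_iff[of ?t "drop (i0 + m) z"] reduced_append_iff[of "take i0 z" "drop i0 z"]
      by simp_all
    have "hd (inv_word (take i0 z)) = inv_letter (z ! p)" "last ?t = z ! (p + m)"
      unfolding t1 t2 by simp_all
    then have "hd (inv_word (take i0 z)) \<noteq> inv_letter (last ?t)"
      using ne by (metis inv_letter_inv_letter)
    with red have "reduced (?t @ inv_word (take i0 z))"
      by (simp only: reduced_append_iff reduced_inv_word) simp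
    with walk m(1) show ?thesis
      by (intro exI[of _ "i0 + m"] exI[of _ "inv_word (take i0 z)"]) simp
  qed
qed

text \<open>
  Without leaves away from \<open>v\<close>, a reduced walk can be continued until it is at \<open>v\<close> or as long as
  desired; in the latter case it closes up, keeping \<open>w\<close> as a prefix.
\<close>

lemma reduced_walk_extend:
  assumes adm: "admissible A V E v" and w: "reduced w" "walk E v w u"
  shows "\<exists>c. reduced (w @ c) \<and> walk E v (w @ c) v"
proof (rule ccontr)
  assume bad: "\<nexists>c. reduced (w @ c) \<and> walk E v (w @ c) v"
  have E: "A_graph A V E" and v: "v \<in> V" and trim: "trim_at V E v"
    using adm by (simp_all add: admissible_def)
  have ext: "\<exists>c y. length c = k \<and> reduced (w @ c) \<and> walk E v (w @ c) y" for k
  proof (induction k)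
    case 0
    then show ?case using w by auto
  next
    case (Suc k)
    then obtain c y where c: "length c = k" "reduced (w @ c)" "walk E v (w @ c) y" by blast
    then have "y \<noteq> v" using bad by auto
    moreover have "y \<in> V" using walk_in[OF E v c(3)] .
    ultimately have "\<not> is_leaf E y" using trim by (simp add: trim_at_def)
    then obtain l x where l: "l \<noteq> inv_letter (last (w @ c))" "step E y l x"
      using non_leaf_extend[OF E] by blast
    have "reduced ((w @ c) @ [l])"
      using c(2) l(1) by (simp only: reduced_append_iff[of "w @ c"]) (simp add: reduced_def)
    moreover have "walk E v ((w @ c) @ [l]) x"
      using c(3) l(2) by (auto simp: walk_append_iff walk_Cons_iff)
    ultimately show ?case
      using c(1) by (intro exI[of _ "c @ [l]"]) auto
  qed
  define k where "k = Suc (length w)"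
  obtain c y where c: "length c = card V * k" "reduced (w @ c)" "walk E v (w @ c) y"
    using ext by blast
  obtain m d where m: "k \<le> m" "reduced (take m (w @ c) @ d)" "walk E v (take m (w @ c) @ d) v"
    using reduced_walk_close[OF E c(2,3) v, of k] c(1) by (auto simp: k_def)
  then have "take m (w @ c) @ d = w @ (take (m - length w) c @ d)"
    by (simp add: k_def)
  with m bad show False by metis
qed

definition closed_words :: "('v \<times> 'a \<times> 'v) set \<Rightarrow> 'v \<Rightarrow> 'a letter list set" where
  "closed_words E v = {w. reduced w \<and> walk E v w v}"

text \<open>
  Whether two words lead to the same vertex is decided by the subgroup: it means that
  \<open>w @ inv_word z\<close> represents an element of it.
\<close>

lemma common_endpoint:
  assumes E: "A_graph A V E" and E': "A_graph A V' E'"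
    and sub: "closed_words E v \<subseteq> closed_words E' v'"
    and w: "walk E v w u" "walk E v z u" "walk E' v' w x" "walk E' v' z y"
  shows "x = y"
proof -
  have "walk E v (w @ inv_word z) v"
    using w(1,2) walk_inv_word walk_append by metis
  then have "reduce (w @ inv_word z) \<in> closed_words E v"
    using walk_reduce[OF E] by (simp add: closed_words_def reduced_reduce)
  then have "walk E' v' (reduce (w @ inv_word z)) v'"
    using sub by (auto simp: closed_words_def)
  then have "walk E' v' (reduce (w @ inv_word z) @ z) y"
    using w(4) by (rule walk_append)
  then have "walk E' v' (reduce (reduce (w @ inv_word z) @ z)) y"
    by (rule walk_reduce[OF E'])
  moreover have "reduce (reduce (w @ inv_word z) @ z) = reduce w"
    using reduce_cancel[of w z "[]"] by (simp add: reduce_reduce_left)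
  ultimately show ?thesis
    using walk_reduce[OF E' w(3)] walk_unique[OF E'] by metis
qed

definition relabel :: "('v \<Rightarrow> 'w) \<Rightarrow> ('v \<times> 'a \<times> 'v) set \<Rightarrow> ('w \<times> 'a \<times> 'w) set" where
  "relabel \<phi> E = (\<lambda>(u, a, v). (\<phi> u, a, \<phi> v)) ` E"

text \<open>
  A vertex goes to the endpoint in the second graph of any word that leads to it in the first; such
  words can be read in the second graph because they are prefixes of elements of the subgroup.
\<close>

lemma admissible_morphism:
  assumes adm: "admissible A V E v" and adm': "admissible A V' E' v'"
    and sub: "closed_words E v \<subseteq> closed_words E' v'"
  shows "\<exists>\<phi>. \<phi> ` V \<subseteq> V' \<and> relabel \<phi> E \<subseteq> E' \<and>
             (\<forall>w u. reduced w \<longrightarrow> walk E v w u \<longrightarrow> walk E' v' w (\<phi> u))"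
proof -
  have E: "A_graph A V E" "graph_connected V E" "v \<in> V" and E': "A_graph A V' E'" "v' \<in> V'"
    using adm adm' by (simp_all add: admissible_def)
  have ex: "\<exists>x. walk E' v' w x" if w: "reduced w" "walk E v w u" for w u
  proof -
    obtain c where "reduced (w @ c)" "walk E v (w @ c) v"
      using reduced_walk_extend[OF adm w] by blast
    then have "walk E' v' (w @ c) v'"
      using sub by (auto simp: closed_words_def)
    then show ?thesis by (auto simp: walk_append_iff)
  qed
  have "\<exists>w. reduced w \<and> walk E v w u" if "u \<in> V" for u
    using connected_reduced_walk[OF E(1,2,3) that] .
  then obtain g where g: "reduced (g u)" "walk E v (g u) u" if "u \<in> V" for u
    by metis
  obtain \<phi> where \<phi>: "walk E' v' (g u) (\<phi> u)" if "u \<in> V" for u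
    using ex[OF g] by metis
  have walk: "walk E' v' w (\<phi> u)" if w: "reduced w" "walk E v w u" for w u
  proof -
    have u: "u \<in> V" using walk_in[OF E(1,3) w(2)] .
    obtain x where x: "walk E' v' w x" using ex[OF w] by blast
    have "x = \<phi> u"
      by (rule common_endpoint[OF E(1) E'(1) sub w(2) g(2)[OF u] x \<phi>[OF u]])
    with x show ?thesis by simp
  qed
  moreover have "\<phi> ` V \<subseteq> V'"
    using \<phi> walk_in[OF E'] by blast
  moreover have "relabel \<phi> E \<subseteq> E'"
  proof
    fix e assume "e \<in> relabel \<phi> E"
    then obtain x a y where e: "e = (\<phi> x, a, \<phi> y)" "(x, a, y) \<in> E"
      by (auto simp: relabel_def)
    have x: "x \<in> V" using e A_graph_subset[OF E(1)] by auto
    let ?w = "reduce (g x @ [(a, True)])"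
    have "walk E v (g x @ [(a, True)]) y"
      using g(2)[OF x] e(2) by (auto simp: walk_append_iff walk_Cons_iff step_def)
    then have "walk E' v' ?w (\<phi> y)"
      by (intro walk walk_reduce[OF E(1)] reduced_reduce)
    then have "walk E' (\<phi> x) (inv_word (g x) @ ?w) (\<phi> y)"
      using walk_inv_word[OF \<phi>[OF x]] by (rule walk_append[rotated])
    then have "walk E' (\<phi> x) (reduce (inv_word (g x) @ ?w)) (\<phi> y)"
      by (rule walk_reduce[OF E'(1)])
    also have "reduce (inv_word (g x) @ ?w) = reduce [(a, True)]"
      using reduce_cancel[of "[]" "g x" "[(a, True)]"] by (simp add: reduce_reduce_right)
    also have "\<dots> = [(a, True)]"
      by (simp add: reduce_def)
    finally show "e \<in> E'"
      by (simp add: e(1) walk_Cons_iff step_def)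
  qed
  ultimately show ?thesis by blast
qed

lemma relabel_cong: "(\<And>u a v. (u, a, v) \<in> E \<Longrightarrow> f u = g u \<and> f v = g v) \<Longrightarrow> relabel f E = relabel g E"
  unfolding relabel_def by (intro image_cong) auto

lemma relabel_comp: "relabel f (relabel g E) = relabel (f \<circ> g) E"
  by (force simp: relabel_def)

lemma relabel_id: "(\<And>u a v. (u, a, v) \<in> E \<Longrightarrow> f u = u \<and> f v = v) \<Longrightarrow> relabel f E = E"
  by (force simp: relabel_def)

lemma admissible_isomorphism:
  assumes adm: "admissible A V E v" and adm': "admissible A V' E' v'"
    and eq: "closed_words E v = closed_words E' v'"
  shows "\<exists>\<phi>. bij_betw \<phi> V V' \<and> \<phi> v = v' \<and> E' = relabel \<phi> E"
proof -
  have E: "A_graph A V E" "graph_connected V E" "v \<in> V"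
    and E': "A_graph A V' E'" "graph_connected V' E'" "v' \<in> V'"
    using adm adm' by (simp_all add: admissible_def)
  obtain \<phi> where \<phi>: "\<phi> ` V \<subseteq> V'" "relabel \<phi> E \<subseteq> E'"
    "\<And>w u. reduced w \<Longrightarrow> walk E v w u \<Longrightarrow> walk E' v' w (\<phi> u)"
    using admissible_morphism[OF adm adm'] eq by auto
  obtain \<psi> where \<psi>: "\<psi> ` V' \<subseteq> V" "relabel \<psi> E' \<subseteq> E"
    "\<And>w u. reduced w \<Longrightarrow> walk E' v' w u \<Longrightarrow> walk E v w (\<psi> u)"
    using admissible_morphism[OF adm' adm] eq by auto
  have inv1: "\<psi> (\<phi> u) = u" if u: "u \<in> V" for u
  proof -
    obtain w where w: "reduced w" "walk E v w u"
      using connected_reduced_walk[OF E u] by blast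
    show ?thesis
      using walk_unique[OF E(1) \<psi>(3)[OF w(1) \<phi>(3)[OF w]] w(2)] .
  qed
  have inv2: "\<phi> (\<psi> u) = u" if u: "u \<in> V'" for u
  proof -
    obtain w where w: "reduced w" "walk E' v' w u"
      using connected_reduced_walk[OF E' u] by blast
    show ?thesis
      using walk_unique[OF E'(1) \<phi>(3)[OF w(1) \<psi>(3)[OF w]] w(2)] .
  qed
  have "bij_betw \<phi> V V'"
    using \<phi>(1) \<psi>(1) inv1 inv2 by (intro bij_betwI[where g = \<psi>]) auto
  moreover have "\<phi> v = v'"
    using \<phi>(3)[of "[]" v] by simp
  moreover have "relabel \<phi> (relabel \<psi> E') = E'"
    unfolding relabel_comp using inv2 A_graph_subset[OF E'(1)] by (intro relabel_id) auto
  moreover have "relabel \<phi> (relabel \<psi> E') \<subseteq> relabel \<phi> E"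
    unfolding relabel_def[of \<phi>] by (rule image_mono[OF \<psi>(2)])
  ultimately show ?thesis
    using \<phi>(2) by (intro exI[of _ \<phi>]) simp
qed

section \<open>The rank of the subgroup of a graph\<close>

lemma free_group_simps [simp]:
  "w \<in> carrier (free_group A) \<longleftrightarrow> set w \<subseteq> A \<times> UNIV \<and> reduced w"
  "u \<otimes>\<^bsub>free_group A\<^esub> w = reduce (u @ w)"
  "\<one>\<^bsub>free_group A\<^esub> = []"
  by (simp_all add: free_group_def)

lemma set_inv_word: "set (inv_word w) \<subseteq> A \<times> UNIV \<longleftrightarrow> set w \<subseteq> A \<times> UNIV"
  by (auto simp: inv_word_def inv_letter_def)

lemma inv_free_group:
  assumes "set w \<subseteq> A \<times> UNIV"
  shows "inv\<^bsub>free_group A\<^esub> (reduce w) = reduce (inv_word w)"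
proof (rule group.inv_equality[OF group_free_group])
  show "reduce w \<in> carrier (free_group A)" "reduce (inv_word w) \<in> carrier (free_group A)"
    using assms set_reduce[of w] set_reduce[of "inv_word w"] set_inv_word[of w A]
    by (auto simp: reduced_reduce)
  show "reduce (inv_word w) \<otimes>\<^bsub>free_group A\<^esub> reduce w = \<one>\<^bsub>free_group A\<^esub>"
    by (simp add: reduce_reduce_left reduce_reduce_right inv_word_def reduce_inverse)
qed

lemma inv_free_group_reduced:
  assumes "w \<in> carrier (free_group A)"
  shows "inv\<^bsub>free_group A\<^esub> w = inv_word w"
  using assms inv_free_group[of w A] reduced_inv_word[of w] by (simp add: reduce_reduced)

lemma closed_words_carrier:
  "A_graph A V E \<Longrightarrow> closed_words E v \<subseteq> carrier (free_group A)"
  by (auto simp: closed_words_def dest: walk_letters)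

lemma subgroup_closed_words:
  assumes E: "A_graph A V E"
  shows "subgroup (closed_words E v) (free_group A)"
proof (rule group.subgroupI[OF group_free_group closed_words_carrier[OF E]])
  show "closed_words E v \<noteq> {}"
    by (auto simp: closed_words_def intro: exI[of _ "[]"])
  show "inv\<^bsub>free_group A\<^esub> w \<in> closed_words E v" if w: "w \<in> closed_words E v" for w
  proof -
    have "inv\<^bsub>free_group A\<^esub> w = inv_word w"
      using w closed_words_carrier[OF E] by (intro inv_free_group_reduced) blast
    then show ?thesis
      using w by (simp add: closed_words_def reduced_inv_word walk_inv_word)
  qed
  show "u \<otimes>\<^bsub>free_group A\<^esub> w \<in> closed_words E v"
    if "u \<in> closed_words E v" "w \<in> closed_words E v" for u w
  proof -
    have "walk E v (u @ w) v"
      using that walk_append[of E v u v w v] by (simp add: closed_words_def)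
    from walk_reduce[OF E this] show ?thesis
      by (simp add: closed_words_def reduced_reduce)
  qed
qed

text \<open>
  The double cover of the graph \<open>E\<close> whose sheets are exchanged along the edges in \<open>F\<close>. A walk in it
  records the parity of the number of its steps along \<open>F\<close>, and this parity is invariant under
  reduction because the cover is again an \<open>A\<close>-graph.
\<close>

definition cover :: "('v \<times> 'a \<times> 'v) set \<Rightarrow> ('v \<times> 'a \<times> 'v) set \<Rightarrow>
    (('v \<times> bool) \<times> 'a \<times> ('v \<times> bool)) set" where
  "cover E F = {((u, b), a, (w, b')) | u b a w b'. (u, a, w) \<in> E \<and> b' = (b \<noteq> ((u, a, w) \<in> F))}"

lemma A_graph_cover:
  assumes E: "A_graph A V E"
  shows "A_graph A (V \<times> UNIV) (cover E F)"
proof (rule A_graphI)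
  show "finite (V \<times> (UNIV :: bool set))"
    using A_graph_finite[OF E] by simp
  show "cover E F \<subseteq> (V \<times> UNIV) \<times> A \<times> (V \<times> UNIV)"
    using A_graph_subset[OF E] by (auto simp: cover_def)
  show "p = p'" if "(q, a, p) \<in> cover E F" "(q, a, p') \<in> cover E F" for q a p p'
    using that by (auto simp: cover_def dest: A_graph_forward_unique[OF E])
  show "p = p'" if "(p, a, q) \<in> cover E F" "(p', a, q) \<in> cover E F" for q a p p'
    using that by (auto simp: cover_def dest: A_graph_backward_unique[OF E])
qed

lemma step_cover_iff:
  "step (cover E F) (u, b) x (w, b') \<longleftrightarrow>
   step E u x w \<and> b' = (b \<noteq> ((if snd x then (u, fst x, w) else (w, fst x, u)) \<in> F))"
  by (auto simp: step_def cover_def)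

lemma walk_cover_lift: "walk E u w x \<Longrightarrow> \<exists>b'. walk (cover E F) (u, b) w (x, b')"
proof (induction w arbitrary: u b)
  case (Cons l w)
  then obtain y where y: "step E u l y" "walk E y w x"
    by (auto simp: walk_Cons_iff)
  then obtain c where "step (cover E F) (u, b) l (y, c)"
    by (auto simp: step_cover_iff)
  moreover obtain b' where "walk (cover E F) (y, c) w (x, b')"
    using Cons.IH[OF y(2)] by blast
  ultimately show ?case by (auto simp: walk_Cons_iff)
qed simp

lemma walk_cover_flip:
  "walk (cover E F) (u, b) w (x, b') \<Longrightarrow> walk (cover E F) (u, b \<noteq> c) w (x, b' \<noteq> c)"
proof (induction w arbitrary: u b)
  case (Cons l w)
  then obtain y d where y: "step (cover E F) (u, b) l (y, d)" "walk (cover E F) (y, d) w (x, b')"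
    by (auto simp: walk_Cons_iff)
  have "step (cover E F) (u, b \<noteq> c) l (y, d \<noteq> c)"
    using y(1) by (auto simp: step_cover_iff)
  with Cons.IH[OF y(2)] show ?case
    unfolding walk_Cons_iff by blast
qed simp

lemma walk_cover_append:
  assumes "walk (cover E F) (u, False) w (y, c)" "walk (cover E F) (y, False) w' (x, c')"
  shows "walk (cover E F) (u, False) (w @ w') (x, c \<noteq> c')"
proof -
  have "walk (cover E F) (y, c) w' (x, c' \<noteq> c)"
    using walk_cover_flip[OF assms(2), of c] by simp
  moreover have "(c' \<noteq> c) = (c \<noteq> c')" by auto
  ultimately show ?thesis
    using walk_append[OF assms(1)] by metis
qed

lemma walk_cover_inv_word:
  assumes "walk (cover E F) (u, False) w (x, c)"
  shows "walk (cover E F) (x, False) (inv_word w) (u, c)"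
  using walk_cover_flip[OF walk_inv_word[OF assms], of c] by simp

lemma walk_cover_edge:
  "(u, a, w) \<in> E \<Longrightarrow> walk (cover E F) (u, False) [(a, True)] (w, (u, a, w) \<in> F)"
  by (auto simp: walk_Cons_iff step_def cover_def)

text \<open>
  Every set \<open>F\<close> of edges gives a homomorphism from the subgroup to the group of order 2, the parity of
  the number of steps along \<open>F\<close>. It is determined by its values on \<open>S\<close>. Conversely \<open>F\<close> can be recovered
  from this homomorphism and the parities of fixed walks from \<open>v\<close> to the other vertices, so that
  \<open>2 ^ card E\<close> is at most \<open>2 ^ card S * 2 ^ (card V - 1)\<close>.
\<close>

lemma rank_lower_bound:
  assumes A: "finite A" and E: "A_graph A V E" "graph_connected V E" and v: "v \<in> V"
    and S: "finite S" "S \<subseteq> closed_words E v" "generate (free_group A) S = closed_words E v"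
  shows "card E + 1 \<le> card S + card V"
proof -
  let ?P = "\<lambda>F u w x c. walk (cover E F) (u, False) w (x, c)"
  have V: "finite V" using A_graph_finite[OF E(1)] .
  have "finite E"
    using V A A_graph_subset[OF E(1)] by (meson finite_SigmaI finite_subset)
  have uniq: "c = c'" if "?P F u w x c" "?P F u w x c'" for F u w x c c'
    using walk_unique[OF A_graph_cover[OF E(1)] that] by simp
  have iff: "?P F u w x True \<longleftrightarrow> c" if "?P F u w x c" for F u w x c
    using that uniq[OF that, of True] by auto
  have red: "?P F u (reduce w) x c" if "?P F u w x c" for F u w x c
    using walk_reduce[OF A_graph_cover[OF E(1)] that] .
  obtain g0 where g0: "walk E v (g0 u) u" if "u \<in> V" for u
    using connected_walk[OF E(2) v] by metis
  define g where "g = g0(v := [])"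
  have g: "walk E v (g u) u" if "u \<in> V" for u
    using g0[OF that] by (simp add: g_def)
  have g_v: "g v = []" by (simp add: g_def)
  have agree: "?P F v w v True \<longleftrightarrow> ?P F' v w v True"
    if eq: "\<And>s. s \<in> S \<Longrightarrow> ?P F v s v True \<longleftrightarrow> ?P F' v s v True"
      and w: "w \<in> generate (free_group A) S" for F F' w
    using w
  proof (induction rule: generate.induct)
    case one
    then show ?case by simp
  next
    case (incl h)
    then show ?case by (rule eq)
  next
    case (inv h)
    then have "inv\<^bsub>free_group A\<^esub> h = inv_word h"
      using S(2) closed_words_carrier[OF E(1)] by (intro inv_free_group_reduced) blast
    moreover have "?P D v (inv_word h) v True \<longleftrightarrow> ?P D v h v True" for D
      using walk_cover_inv_word[of E D v h v True] walk_cover_inv_word[of E D v "inv_word h" v True]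
      by auto
    ultimately show ?case using eq[OF inv] by simp
  next
    case (eng h1 h2)
    have "h1 \<in> closed_words E v" "h2 \<in> closed_words E v"
      using eng.hyps S(3) by simp_all
    then have h: "walk E v h1 v" "walk E v h2 v" by (simp_all add: closed_words_def)
    have "?P D v (reduce (h1 @ h2)) v True \<longleftrightarrow> (?P D v h1 v True \<noteq> ?P D v h2 v True)" for D
    proof -
      obtain c1 where c1: "?P D v h1 v c1"
        using walk_cover_lift[OF h(1)] by blast
      obtain c2 where c2: "?P D v h2 v c2"
        using walk_cover_lift[OF h(2)] by blast
      note c = c1 c2
      show ?thesis
        using iff[OF red[OF walk_cover_append[OF c]]] iff[OF c1] iff[OF c2] by simp
    qed
    then show ?case using eng.IH by simp
  qed
  \<comment> \<open>\<open>v\<close> is left out because its walk is empty, which saves the factor 2 that makes the bound sharp\<close>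
  define f where "f F = ({u \<in> V - {v}. ?P F v (g u) u True}, {s \<in> S. ?P F v s v True})" for F
  have "inj_on f (Pow E)"
  proof (rule inj_onI)
    fix F F' assume F: "F \<in> Pow E" "F' \<in> Pow E" and eq: "f F = f F'"
    have eqS: "?P F v s v True \<longleftrightarrow> ?P F' v s v True" if "s \<in> S" for s
      using eq that by (auto simp: f_def)
    have eqV: "?P F v (g u) u c \<longleftrightarrow> ?P F' v (g u) u c" if u: "u \<in> V" for u c
    proof (cases "u = v")
      case True
      then show ?thesis by (simp add: g_v)
    next
      case False
      then have "?P F v (g u) u True \<longleftrightarrow> ?P F' v (g u) u True"
        using eq u by (auto simp: f_def)
      moreover obtain d where "?P F v (g u) u d"
        using walk_cover_lift[OF g[OF u]] by blast
      moreover obtain d' where "?P F' v (g u) u d'"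
        using walk_cover_lift[OF g[OF u]] by blast
      ultimately show ?thesis using iff uniq by metis
    qed
    have "e \<in> F \<longleftrightarrow> e \<in> F'" if eE: "e \<in> E" for e
    proof -
      obtain x a y where e: "e = (x, a, y)" by (cases e)
      with eE A_graph_subset[OF E(1)] have xy: "x \<in> V" "y \<in> V" by auto
      obtain p where p: "?P F v (g x) x p"
        using walk_cover_lift[OF g[OF xy(1)]] by blast
      obtain q where q: "?P F v (g y) y q"
        using walk_cover_lift[OF g[OF xy(2)]] by blast
      note pq = p q
      let ?z = "(g x @ [(a, True)]) @ inv_word (g y)"
      have z: "?P D v (reduce ?z) v ((p \<noteq> (e \<in> D)) \<noteq> q)"
        if "?P D v (g x) x p" "?P D v (g y) y q" for D
        unfolding e using that eE e
        by (intro red walk_cover_append walk_cover_inv_word) (auto intro: walk_cover_edge)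
      have "walk E v ?z v"
        using g[OF xy(1)] walk_inv_word[OF g[OF xy(2)]] eE e
        by (auto simp: walk_append_iff walk_Cons_iff step_def)
      then have "reduce ?z \<in> generate (free_group A) S"
        unfolding S(3) using walk_reduce[OF E(1)] by (simp add: closed_words_def reduced_reduce)
      from agree[OF eqS this] have "?P F v (reduce ?z) v True \<longleftrightarrow> ?P F' v (reduce ?z) v True"
        by simp
      moreover have "?P F v (reduce ?z) v ((p \<noteq> (e \<in> F)) \<noteq> q)"
        "?P F' v (reduce ?z) v ((p \<noteq> (e \<in> F')) \<noteq> q)"
        using z pq eqV xy by blast+
      ultimately have "((p \<noteq> (e \<in> F)) \<noteq> q) = ((p \<noteq> (e \<in> F')) \<noteq> q)"
        using iff by simp
      then show ?thesis by auto
    qed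
    with F show "F = F'" by blast
  qed
  moreover have "f ` Pow E \<subseteq> Pow (V - {v}) \<times> Pow S"
    by (auto simp: f_def)
  moreover have "finite (Pow (V - {v}) \<times> Pow S)"
    using V S(1) by simp
  ultimately have "card (Pow E) \<le> card (Pow (V - {v}) \<times> Pow S)"
    by (rule card_inj_on_le)
  then have "(2 :: nat) ^ card E \<le> 2 ^ (card (V - {v}) + card S)"
    using V S(1) \<open>finite E\<close> by (simp add: card_cartesian_product card_Pow power_add)
  then have "card E \<le> card (V - {v}) + card S"
    by simp
  moreover have "card V = Suc (card (V - {v}))"
    using V v by (metis card_Suc_Diff1)
  ultimately show ?thesis by simp
qed

lemma walk_crossing:
  "walk E u w y \<Longrightarrow> u \<in> U \<Longrightarrow> y \<notin> U \<Longrightarrow> \<exists>p\<in>U. \<exists>q. q \<notin> U \<and> (\<exists>x. step E p x q)"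
proof (induction w arbitrary: u)
  case (Cons l w)
  then obtain t where "step E u l t" "walk E t w y"
    by (auto simp: walk_Cons_iff)
  with Cons show ?case by (cases "t \<in> U") blast+
qed simp

text \<open>
  A tree \<open>T\<close> on the vertex set \<open>U\<close>, grown from \<open>v\<close> edge by edge, where \<open>g u\<close> is the word of the
  path in \<open>T\<close> from \<open>v\<close> to \<open>u\<close>.
\<close>

lemma partial_spanning_tree:
  assumes A: "finite A" and E: "A_graph A V E" "graph_connected V E" and v: "v \<in> V" and k: "Suc k \<le> card V"
  shows "\<exists>U T g. v \<in> U \<and> U \<subseteq> V \<and> card U = Suc k \<and> T \<subseteq> E \<and> T \<subseteq> U \<times> UNIV \<times> U \<and> card T = k \<and>
           (\<forall>u\<in>U. walk E v (g u) u) \<and>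
           (\<forall>(x, a, y)\<in>T. reduce (g x @ [(a, True)]) = reduce (g y)) \<and> g v = []"
  using k
proof (induction k)
  case 0
  show ?case
    using v by (intro exI[of _ "{v}"] exI[of _ "{}"] exI[of _ "\<lambda>_. []"]) auto
next
  case (Suc k)
  have "Suc k \<le> card V" using Suc.prems by simp
  from Suc.IH[OF this] obtain U T g where U: "v \<in> U" "U \<subseteq> V" "card U = Suc k"
    and T: "T \<subseteq> E" "T \<subseteq> U \<times> UNIV \<times> U" "card T = k"
    and g: "\<forall>u\<in>U. walk E v (g u) u"
      "\<forall>(x, a, y)\<in>T. reduce (g x @ [(a, True)]) = reduce (g y)" "g v = []"
    by blast
  have V: "finite V" using A_graph_finite[OF E(1)] .
  have finU: "finite U" using U(2) V by (rule finite_subset)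
  have finT: "finite T"
    using T(1) V A A_graph_subset[OF E(1)] by (meson finite_SigmaI finite_subset)
  obtain y where "y \<in> V" "y \<notin> U"
    using Suc.prems U V by (metis card_mono finU not_less_eq_eq subsetI)
  then obtain w where "walk E v w y"
    using connected_walk[OF E(2) v] by blast
  then obtain p q x where p: "p \<in> U" "q \<notin> U" "step E p x q"
    using walk_crossing[of E v w y U] U(1) \<open>y \<notin> U\<close> by blast
  have "q \<in> V" using step_in[OF E(1) p(3)] by simp
  define e where "e = (if snd x then (p, fst x, q) else (q, fst x, p))"
  have e: "e \<in> E" using p(3) by (simp add: e_def step_def)
  have "e \<notin> T" using T(2) p(2) by (auto simp: e_def split: if_splits)
  define g' where "g' = g(q := g p @ [x])"
  have "reduce (g' s @ [(a, True)]) = reduce (g' t)" if "(s, a, t) \<in> insert e T" for s a t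
  proof (cases "(s, a, t) \<in> T")
    case True
    then have "s \<noteq> q" "t \<noteq> q" using T(2) p(2) by auto
    then show ?thesis using g(2) True by (auto simp: g'_def)
  next
    case False
    then have eq: "(s, a, t) = e" using that by simp
    show ?thesis
    proof (cases "snd x")
      case True
      with eq have "s = p" "t = q" "x = (a, True)" by (auto simp: e_def prod_eq_iff)
      then show ?thesis using p by (auto simp: g'_def)
    next
      case False
      with eq have *: "s = q" "t = p" "x = (a, False)" by (auto simp: e_def prod_eq_iff)
      have "reduce (g p @ inv_word [(a, True)] @ [(a, True)] @ []) = reduce (g p @ [])"
        by (rule reduce_cancel)
      then show ?thesis using p * by (auto simp: g'_def inv_letter_def)
    qed
  qed
  moreover have "walk E v (g' u) u" if "u \<in> insert q U" for u
    using that g(1) p by (auto simp: g'_def walk_append_iff walk_Cons_iff)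
  moreover have "insert e T \<subseteq> insert q U \<times> UNIV \<times> insert q U"
    using T(2) p(1) by (auto simp: e_def)
  moreover have "g' v = []" using U(1) p(2) g(3) by (auto simp: g'_def)
  moreover have "card (insert q U) = Suc (Suc k)" "card (insert e T) = Suc k"
    using U(3) T(3) finU finT p(2) \<open>e \<notin> T\<close> by simp_all
  ultimately show ?case
    using U(1,2) T(1) \<open>q \<in> V\<close> e
    by (intro exI[of _ "insert q U"] exI[of _ "insert e T"] exI[of _ g']) auto
qed

text \<open>
  The classical generators: for an edge outside a spanning tree, run along the tree to its origin,
  cross it, and return to \<open>v\<close> along the tree. The same word for an edge of the tree reduces to the empty
  word, and every closed walk is a product of such words and their inverses.
\<close>

lemma rank_upper_bound:
  assumes A: "finite A" and E: "A_graph A V E" "graph_connected V E" and v: "v \<in> V"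
  shows "\<exists>S. finite S \<and> S \<subseteq> closed_words E v \<and> generate (free_group A) S = closed_words E v \<and>
           card S + card V \<le> card E + 1"
proof -
  let ?H = "closed_words E v" and ?G = "free_group A"
  have V: "finite V" using A_graph_finite[OF E(1)] .
  have finE: "finite E"
    using V A A_graph_subset[OF E(1)] by (meson finite_SigmaI finite_subset)
  have "Suc (card V - 1) = card V"
    using V v card_gt_0_iff[of V] by force
  then have "Suc (card V - 1) \<le> card V" by simp
  from partial_spanning_tree[OF A E v this] \<open>Suc (card V - 1) = card V\<close>
  obtain U T g where UT: "U \<subseteq> V" "card U = card V" "T \<subseteq> E" "card T = card V - 1"
    and gU: "\<forall>u\<in>U. walk E v (g u) u"
    and gT0: "\<forall>(x, a, y)\<in>T. reduce (g x @ [(a, True)]) = reduce (g y)" and gv: "g v = []"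
    by metis
  have gT: "reduce (g x @ [(a, True)]) = reduce (g y)" if "(x, a, y) \<in> T" for x a y
    using gT0 that by auto
  have "U = V" using UT V by (simp add: card_subset_eq)
  with gU have g: "walk E v (g u) u" if "u \<in> V" for u
    using that by simp
  define h where "h = (\<lambda>(x, a, y). reduce (g x @ [(a, True)] @ inv_word (g y)))"
  define S where "S = h ` (E - T)"
  have "finite S" using finE by (simp add: S_def)
  have "card S \<le> card (E - T)"
    unfolding S_def using finE by (intro card_image_le) simp
  also have "\<dots> = card E - (card V - 1)"
    using UT finE by (simp add: card_Diff_subset finite_subset)
  finally have card: "card S + card V \<le> card E + 1"
    using card_mono[OF finE UT(3)] UT(4) by linarith
  have hE: "walk E v (g x @ [(a, True)] @ inv_word (g y)) v" if "(x, a, y) \<in> E" for x a y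
    using that g[of x] walk_inv_word[OF g[of y]] A_graph_subset[OF E(1)]
    by (auto simp: walk_append_iff walk_Cons_iff step_def)
  have SH: "S \<subseteq> ?H"
    using walk_reduce[OF E(1) hE] by (auto simp: S_def h_def closed_words_def reduced_reduce)
  have sub: "subgroup (generate ?G S) ?G"
    using SH closed_words_carrier[OF E(1)] by (intro group.generate_is_subgroup[OF group_free_group]) blast
  have fw: "reduce (g x @ [(a, True)] @ inv_word (g y)) \<in> generate ?G S" if "(x, a, y) \<in> E" for x a y
  proof (cases "(x, a, y) \<in> T")
    case True
    have "reduce (g x @ [(a, True)] @ inv_word (g y)) = reduce (g y @ inv_word (g y) @ [])"
      using reduce_cong[OF gT[OF True], of "[]" "inv_word (g y)"] by simp
    also have "\<dots> = []"
      using reduce_cancel'[of "[]" "g y" "[]"] by (simp add: reduce_def)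
    finally show ?thesis using generate.one[of ?G S] by simp
  next
    case False
    then have "h (x, a, y) \<in> S" using that by (auto simp: S_def)
    then show ?thesis using generate.incl[of _ S ?G] by (simp add: h_def)
  qed
  have st: "reduce (g x @ [l] @ inv_word (g y)) \<in> generate ?G S" if l: "step E x l y" for x l y
  proof (cases "snd l")
    case True
    then show ?thesis using fw[of x "fst l" y] l by (cases l) (auto simp: step_def)
  next
    case False
    then have e: "(y, fst l, x) \<in> E" and l': "l = (fst l, False)"
      using l by (auto simp: step_def prod_eq_iff)
    let ?z = "g y @ [(fst l, True)] @ inv_word (g x)"
    have "inv\<^bsub>?G\<^esub> (reduce ?z) = reduce (inv_word ?z)"
      using walk_letters[OF E(1) hE[OF e]] by (rule inv_free_group)
    moreover have "inv_word ?z = g x @ [l] @ inv_word (g y)"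
      by (subst l') (simp add: inv_letter_def)
    ultimately show ?thesis
      using subgroup.m_inv_closed[OF sub fw[OF e]] by simp
  qed
  have walk: "reduce (g x @ w @ inv_word (g y)) \<in> generate ?G S" if "walk E x w y" for x w y
    using that
  proof (induction w arbitrary: x)
    case Nil
    then show ?case
      using reduce_cancel'[of "[]" "g x" "[]"] generate.one[of ?G S] by (simp add: reduce_def)
  next
    case (Cons l w)
    then obtain t where t: "step E x l t" "walk E t w y" by (auto simp: walk_Cons_iff)
    have "reduce (g x @ [l] @ inv_word (g t)) \<otimes>\<^bsub>?G\<^esub> reduce (g t @ w @ inv_word (g y)) \<in> generate ?G S"
      using generate.eng[OF st[OF t(1)] Cons.IH[OF t(2)]] .
    moreover have "reduce (g x @ [l] @ inv_word (g t)) \<otimes>\<^bsub>?G\<^esub> reduce (g t @ w @ inv_word (g y)) =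
        reduce (g x @ (l # w) @ inv_word (g y))"
      using reduce_cancel[of "g x @ [l]" "g t" "w @ inv_word (g y)"]
      by (simp add: reduce_reduce_left reduce_reduce_right)
    ultimately show ?case by simp
  qed
  have "generate ?G S = ?H"
  proof
    show "generate ?G S \<subseteq> ?H"
      using group.generate_subgroup_incl[OF group_free_group SH subgroup_closed_words[OF E(1)]] .
    show "?H \<subseteq> generate ?G S"
    proof
      fix w assume "w \<in> ?H"
      then have "walk E v w v" "reduce w = w" by (simp_all add: closed_words_def reduce_reduced)
      with walk[of v w v] gv show "w \<in> generate ?G S" by simp
    qed
  qed
  with \<open>finite S\<close> SH card show ?thesis by blast
qed

lemma rank_closed_words:
  assumes A: "finite A" and adm: "admissible A V E v"
  shows "fg_subgroup (free_group A) (closed_words E v)"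
    and "subgroup_rank (free_group A) (closed_words E v) + card V = card E + 1"
proof -
  have E: "A_graph A V E" "graph_connected V E" and v: "v \<in> V"
    using adm by (simp_all add: admissible_def)
  obtain S where S: "finite S" "S \<subseteq> closed_words E v" "generate (free_group A) S = closed_words E v"
    "card S + card V \<le> card E + 1"
    using rank_upper_bound[OF A E v] by blast
  show "fg_subgroup (free_group A) (closed_words E v)"
    unfolding fg_subgroup_def using subgroup_closed_words[OF E(1)] S by blast
  have "subgroup_rank (free_group A) (closed_words E v) = card S"
    unfolding subgroup_rank_def
  proof (rule Least_equality)
    fix k assume "\<exists>S. finite S \<and> S \<subseteq> closed_words E v \<and>
      generate (free_group A) S = closed_words E v \<and> card S = k"
    then have "card E + 1 \<le> k + card V"
      using rank_lower_bound[OF A E v] by blast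
    then show "card S \<le> k" using S(4) by linarith
  qed (use S in blast)
  then show "subgroup_rank (free_group A) (closed_words E v) + card V = card E + 1"
    using S(4) rank_lower_bound[OF A E v S(1-3)] by linarith
qed

section \<open>From graphs to subgroups\<close>

lemma walk_relabel: "walk E u w x \<Longrightarrow> walk (relabel \<phi> E) (\<phi> u) w (\<phi> x)"
proof (induction w arbitrary: u)
  case (Cons l w)
  then obtain y where y: "step E u l y" "walk E y w x"
    by (auto simp: walk_Cons_iff)
  have "step (relabel \<phi> E) (\<phi> u) l (\<phi> y)"
    using y(1) by (force simp: step_def relabel_def split: if_splits)
  with Cons.IH[OF y(2)] show ?case
    by (auto simp: walk_Cons_iff)
qed simp

lemma walk_imp_connected:
  assumes "\<And>u v. u \<in> V \<Longrightarrow> v \<in> V \<Longrightarrow> \<exists>w. walk E u w v"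
  shows "graph_connected V E"
proof -
  have "(u, v) \<in> {(x, y). \<exists>a. (x, a, y) \<in> E \<or> (y, a, x) \<in> E}\<^sup>*" if "walk E u w v" for u w v
    using that
  proof (induction w arbitrary: u)
    case (Cons l w)
    then obtain y where "step E u l y" "walk E y w v"
      by (auto simp: walk_Cons_iff)
    then have "(u, y) \<in> {(x, y). \<exists>a. (x, a, y) \<in> E \<or> (y, a, x) \<in> E}"
      by (auto simp: step_def split: if_splits)
    then show ?case
      using Cons.IH[OF \<open>walk E y w v\<close>] by (rule converse_rtrancl_into_rtrancl)
  qed simp
  then show ?thesis
    using assms unfolding graph_connected_def by blast
qed

lemma relabel_inv_into:
  assumes "inj_on \<phi> V" "E \<subseteq> V \<times> UNIV \<times> V"
  shows "relabel (inv_into V \<phi>) (relabel \<phi> E) = E"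
  unfolding relabel_comp using assms by (intro relabel_id) auto

lemma closed_words_relabel:
  assumes inj: "inj_on \<phi> V" and E: "E \<subseteq> V \<times> UNIV \<times> V" and v: "v \<in> V"
  shows "closed_words (relabel \<phi> E) (\<phi> v) = closed_words E v"
proof
  show "closed_words E v \<subseteq> closed_words (relabel \<phi> E) (\<phi> v)"
    by (auto simp: closed_words_def intro: walk_relabel)
  have "walk E v w v" if "walk (relabel \<phi> E) (\<phi> v) w (\<phi> v)" for w
    using walk_relabel[OF that, of "inv_into V \<phi>"] relabel_inv_into[OF inj E] inj v by simp
  then show "closed_words (relabel \<phi> E) (\<phi> v) \<subseteq> closed_words E v"
    by (auto simp: closed_words_def)
qed

lemma occurrences_relabel:
  assumes inj: "inj_on \<phi> V" and E: "E \<subseteq> V \<times> UNIV \<times> V" and w: "w \<in> V"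
  shows "occurrences (relabel \<phi> E) (\<phi> w) = occurrences E w"
proof -
  let ?f = "\<lambda>(u, a, v). (\<phi> u, a, \<phi> v)"
  have eq: "\<phi> u = \<phi> x \<longleftrightarrow> u = x" if "u \<in> V" "x \<in> V" for u x
    using inj that by (auto dest: inj_onD)
  have f: "inj_on ?f E"
  proof (rule inj_onI)
    fix p q assume pq: "p \<in> E" "q \<in> E" "?f p = ?f q"
    obtain u a v u' a' v' where "p = (u, a, v)" "q = (u', a', v')"
      by (cases p; cases q) blast
    with pq E show "p = q" using eq[of u u'] eq[of v v'] by auto
  qed
  have card_f: "card (?f ` B) = card B" if "B \<subseteq> E" for B
    using inj_on_subset[OF f that] by (rule card_image)
  have image: "{e \<in> relabel \<phi> E. P e} = ?f ` {e \<in> E. P (?f e)}" for P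
    unfolding relabel_def by blast
  have out: "{(u, a, v). (u, a, v) \<in> X \<and> u = c} = {e \<in> X. fst e = c}"
    and in': "{(u, a, v). (u, a, v) \<in> X \<and> v = c} = {e \<in> X. snd (snd e) = c}"
    for X :: "('x \<times> 'y \<times> 'x) set" and c
    by auto
  have "{e \<in> E. fst (?f e) = \<phi> w} = {e \<in> E. fst e = w}"
    "{e \<in> E. snd (snd (?f e)) = \<phi> w} = {e \<in> E. snd (snd e) = w}"
    using E eq w by auto
  then show ?thesis
    unfolding occurrences_def out in' image by (simp add: card_f)
qed

lemma admissible_relabel:
  assumes inj: "inj_on \<phi> V" and adm: "admissible A V E v"
  shows "admissible A (\<phi> ` V) (relabel \<phi> E) (\<phi> v)"
proof -
  have E: "A_graph A V E" and con: "graph_connected V E" and v: "v \<in> V" and trim: "trim_at V E v"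
    using adm by (simp_all add: admissible_def)
  have E': "E \<subseteq> V \<times> UNIV \<times> V" using A_graph_subset[OF E] by auto
  have "A_graph A (\<phi> ` V) (relabel \<phi> E)"
  proof (rule A_graphI)
    show "finite (\<phi> ` V)" using A_graph_finite[OF E] by simp
    show "relabel \<phi> E \<subseteq> \<phi> ` V \<times> A \<times> \<phi> ` V"
      using A_graph_subset[OF E] by (auto simp: relabel_def)
    show "y = y'" if xy: "(x, a, y) \<in> relabel \<phi> E" "(x, a, y') \<in> relabel \<phi> E" for x a y y'
    proof -
      obtain u v where 1: "x = \<phi> u" "y = \<phi> v" "(u, a, v) \<in> E"
        using xy(1) by (auto simp: relabel_def)
      obtain u' v' where 2: "x = \<phi> u'" "y' = \<phi> v'" "(u', a, v') \<in> E"
        using xy(2) by (auto simp: relabel_def)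
      have "u = u'" using inj_onD[OF inj, of u u'] 1 2 E' by auto
      with 1 2 show ?thesis using A_graph_forward_unique[OF E, of u a v v'] by simp
    qed
    show "x = x'" if xy: "(x, a, y) \<in> relabel \<phi> E" "(x', a, y) \<in> relabel \<phi> E" for x x' a y
    proof -
      obtain u v where 1: "x = \<phi> u" "y = \<phi> v" "(u, a, v) \<in> E"
        using xy(1) by (auto simp: relabel_def)
      obtain u' v' where 2: "x' = \<phi> u'" "y = \<phi> v'" "(u', a, v') \<in> E"
        using xy(2) by (auto simp: relabel_def)
      have "v = v'" using inj_onD[OF inj, of v v'] 1 2 E' by auto
      with 1 2 show ?thesis using A_graph_backward_unique[OF E, of u a v u'] by simp
    qed
  qed
  moreover have "graph_connected (\<phi> ` V) (relabel \<phi> E)"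
  proof (rule walk_imp_connected)
    fix x y assume "x \<in> \<phi> ` V" "y \<in> \<phi> ` V"
    then obtain u v where uv: "x = \<phi> u" "y = \<phi> v" "u \<in> V" "v \<in> V" by auto
    then obtain w where "walk E u w v"
      using connected_walk[OF con] by blast
    then show "\<exists>w. walk (relabel \<phi> E) x w y"
      using walk_relabel[of E u w v \<phi>] uv(1,2) by auto
  qed
  moreover have "trim_at (\<phi> ` V) (relabel \<phi> E) (\<phi> v)"
    using trim occurrences_relabel[OF inj E'] by (auto simp: trim_at_def is_leaf_def)
  ultimately show ?thesis
    using v by (simp add: admissible_def)
qed

definition standard_graphs :: "'a set \<Rightarrow> nat \<Rightarrow> (nat \<times> 'a \<times> nat) set set" where
  "standard_graphs A n = {E. admissible A {..<n} E 0}"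

lemma relabel_standard_graph:
  assumes \<pi>: "\<pi> permutes {1..<n}" and n: "n > 0" and E: "E \<in> standard_graphs A n"
  shows "relabel \<pi> E \<in> standard_graphs A n" "closed_words (relabel \<pi> E) 0 = closed_words E 0"
proof -
  have "{1..<n} \<subseteq> {..<n}" by auto
  then have \<pi>': "\<pi> permutes {..<n}" using \<pi> by (rule permutes_subset[rotated])
  have 0: "\<pi> 0 = 0" using \<pi> by (rule permutes_not_in) simp
  have inj: "inj_on \<pi> {..<n}" using permutes_inj_on[OF \<pi>'] .
  have "E \<subseteq> {..<n} \<times> UNIV \<times> {..<n}"
    using E by (auto simp: standard_graphs_def dest!: admissible_A_graph A_graph_subset)
  then show "closed_words (relabel \<pi> E) 0 = closed_words E 0"
    using closed_words_relabel[OF inj, of E 0] n 0 by simp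
  show "relabel \<pi> E \<in> standard_graphs A n"
    using admissible_relabel[OF inj, of A E 0] E permutes_image[OF \<pi>'] 0 by (simp add: standard_graphs_def)
qed

text \<open>
  The graphs of one subgroup are the relabellings of one of them by permutations fixing \<open>0\<close>. Distinct
  permutations give distinct graphs, since every vertex is the endpoint of a word read from \<open>0\<close>.
\<close>

lemma card_standard_graphs_fibre:
  assumes n: "n > 0" and E: "E \<in> standard_graphs A n"
  shows "card {E' \<in> standard_graphs A n. closed_words E' 0 = closed_words E 0} = fact (n - 1)"
proof -
  let ?P = "{\<pi>. \<pi> permutes {1..<n}}"
  have adm: "admissible A {..<n} E 0" using E by (simp add: standard_graphs_def)
  have AE: "A_graph A {..<n} E" "graph_connected {..<n} E"
    using adm by (simp_all add: admissible_def)
  have "{E' \<in> standard_graphs A n. closed_words E' 0 = closed_words E 0} = (\<lambda>\<pi>. relabel \<pi> E) ` ?P"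
  proof
    show "(\<lambda>\<pi>. relabel \<pi> E) ` ?P \<subseteq> {E' \<in> standard_graphs A n. closed_words E' 0 = closed_words E 0}"
      using relabel_standard_graph[OF _ n E] by auto
    show "{E' \<in> standard_graphs A n. closed_words E' 0 = closed_words E 0} \<subseteq> (\<lambda>\<pi>. relabel \<pi> E) ` ?P"
    proof
      fix E' assume "E' \<in> {E' \<in> standard_graphs A n. closed_words E' 0 = closed_words E 0}"
      then have E': "admissible A {..<n} E' 0" "closed_words E 0 = closed_words E' 0"
        by (simp_all add: standard_graphs_def)
      obtain \<phi> where \<phi>: "bij_betw \<phi> {..<n} {..<n}" "\<phi> 0 = 0" "E' = relabel \<phi> E"
        using admissible_isomorphism[OF adm E'] by blast
      define \<pi> where "\<pi> x = (if x < n then \<phi> x else x)" for x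
      have "bij_betw \<pi> {..<n} {..<n}"
        using \<phi>(1) by (subst bij_betw_cong[of _ _ \<phi>]) (auto simp: \<pi>_def)
      then have "\<pi> permutes {..<n}"
        by (rule bij_imp_permutes) (simp add: \<pi>_def)
      then have "\<pi> permutes {1..<n}"
        by (rule permutes_superset) (use \<phi>(2) in \<open>auto simp: \<pi>_def Suc_le_eq\<close>)
      moreover have "relabel \<pi> E = relabel \<phi> E"
        using A_graph_subset[OF AE(1)] by (intro relabel_cong) (auto simp: \<pi>_def)
      ultimately show "E' \<in> (\<lambda>\<pi>. relabel \<pi> E) ` ?P"
        using \<phi>(3) by auto
    qed
  qed
  moreover have "inj_on (\<lambda>\<pi>. relabel \<pi> E) ?P"
  proof (rule inj_onI)
    fix \<pi> \<sigma> assume \<pi>: "\<pi> \<in> ?P" "\<sigma> \<in> ?P" and eq: "relabel \<pi> E = relabel \<sigma> E"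
    have 0: "\<pi> 0 = 0" "\<sigma> 0 = 0"
      using \<pi> permutes_not_in[of _ "{1..<n}" 0] by auto
    have G: "A_graph A {..<n} (relabel \<sigma> E)"
      using relabel_standard_graph(1)[OF _ n E, of \<sigma>] \<pi> by (simp add: standard_graphs_def admissible_def)
    have "\<pi> u = \<sigma> u" for u
    proof (cases "u < n")
      case True
      then obtain w where w: "walk E 0 w u"
        using connected_walk[OF AE(2), of 0 u] n by auto
      show ?thesis
        using walk_relabel[OF w, of \<pi>] walk_relabel[OF w, of \<sigma>] walk_unique[OF G] 0 eq by simp
    next
      case False
      then show ?thesis
        using \<pi> by (simp add: permutes_not_in)
    qed
    then show "\<pi> = \<sigma>" by blast
  qed
  ultimately show ?thesis
    using card_permutations[of "{1..<n}" "n - 1"] by (simp add: card_image)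
qed

lemma subgroups_of_size_eq:
  assumes A: "finite A" and n: "n > 0"
  shows "subgroups_of_size A n = (\<lambda>E. closed_words E 0) ` standard_graphs A n"
proof
  show "(\<lambda>E. closed_words E 0) ` standard_graphs A n \<subseteq> subgroups_of_size A n"
  proof
    fix H assume "H \<in> (\<lambda>E. closed_words E 0) ` standard_graphs A n"
    then obtain E where E: "admissible A {..<n} E 0" "H = closed_words E 0"
      by (auto simp: standard_graphs_def)
    then have "graphical_representation A {..<n} E 0 H"
      by (simp add: graphical_representation_def closed_words_def)
    moreover have "fg_subgroup (free_group A) H"
      using rank_closed_words(1)[OF A E(1)] E(2) by simp
    moreover have "card {..<n} = n" by simp
    ultimately show "H \<in> subgroups_of_size A n"
      unfolding subgroups_of_size_def by blast
  qed
  show "subgroups_of_size A n \<subseteq> (\<lambda>E. closed_words E 0) ` standard_graphs A n"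
  proof
    fix H assume "H \<in> subgroups_of_size A n"
    then obtain V :: "nat set" and E v where H: "graphical_representation A V E v H" "card V = n"
      unfolding subgroups_of_size_def by blast
    then have adm: "admissible A V E v" and cw: "H = closed_words E v"
      by (simp_all add: graphical_representation_def closed_words_def)
    have V: "finite V" "v \<in> V" and E: "E \<subseteq> V \<times> UNIV \<times> V"
      using adm A_graph_finite[of A V E] A_graph_subset[of A V E] by (auto simp: admissible_def)
    obtain h where h: "bij_betw h V {..<n}"
      using ex_bij_betw_finite_nat[OF V(1)] H(2) by (auto simp: atLeast0LessThan)
    \<comment> \<open>an arbitrary numbering of the vertices, corrected so that the base point becomes \<open>0\<close>\<close>
    define \<phi> where "\<phi> = Transposition.transpose (h v) 0 \<circ> h"
    have "h v < n" using h V(2) by (auto simp: bij_betw_def)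
    then have "bij_betw (Transposition.transpose (h v) 0) {..<n} {..<n}"
      using n permutes_imp_bij[OF permutes_swap_id[of "h v" "{..<n}" 0]] by simp
    with h have \<phi>: "bij_betw \<phi> V {..<n}"
      unfolding \<phi>_def by (rule bij_betw_trans)
    have "\<phi> v = 0" by (simp add: \<phi>_def)
    moreover have inj: "inj_on \<phi> V" "\<phi> ` V = {..<n}"
      using \<phi> by (simp_all add: bij_betw_def)
    ultimately have "relabel \<phi> E \<in> standard_graphs A n"
      using admissible_relabel[OF inj(1) adm] by (simp add: standard_graphs_def)
    moreover have "closed_words (relabel \<phi> E) 0 = H"
      using closed_words_relabel[OF inj(1) E V(2)] \<open>\<phi> v = 0\<close> cw by simp
    ultimately show "H \<in> (\<lambda>E. closed_words E 0) ` standard_graphs A n"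
      by blast
  qed
qed

lemma sum_standard_graphs:
  fixes f :: "'a letter list set \<Rightarrow> real"
  assumes A: "finite A" and n: "n > 0"
  shows "(\<Sum>E\<in>standard_graphs A n. f (closed_words E 0)) = fact (n - 1) * (\<Sum>H\<in>subgroups_of_size A n. f H)"
    and "finite (subgroups_of_size A n)"
proof -
  have "standard_graphs A n \<subseteq> A_graphs A {..<n}"
    by (auto simp: standard_graphs_def A_graphs_def admissible_def)
  then have fin: "finite (standard_graphs A n)"
    using finite_A_graphs[OF A finite_lessThan] by (rule finite_subset)
  then show finS: "finite (subgroups_of_size A n)"
    by (simp add: subgroups_of_size_eq[OF A n])
  have "(\<Sum>E\<in>standard_graphs A n. f (closed_words E 0)) =
      (\<Sum>H\<in>subgroups_of_size A n. \<Sum>E\<in>{E \<in> standard_graphs A n. closed_words E 0 = H}. f (closed_words E 0))"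
    using subgroups_of_size_eq[OF A n] by (intro sum.group[symmetric] fin finS) simp
  also have "\<dots> = (\<Sum>H\<in>subgroups_of_size A n. fact (n - 1) * f H)"
  proof (rule sum.cong)
    fix H assume "H \<in> subgroups_of_size A n"
    then obtain E where E: "E \<in> standard_graphs A n" "H = closed_words E 0"
      by (auto simp: subgroups_of_size_eq[OF A n])
    show "(\<Sum>E\<in>{E \<in> standard_graphs A n. closed_words E 0 = H}. f (closed_words E 0)) = fact (n - 1) * f H"
      using card_standard_graphs_fibre[OF n E(1)] E(2) by simp
  qed simp
  finally show "(\<Sum>E\<in>standard_graphs A n. f (closed_words E 0)) = fact (n - 1) * (\<Sum>H\<in>subgroups_of_size A n. f H)"
    by (simp add: sum_distrib_left)
qed

text \<open>
  Passing from all graphs to the admissible ones costs a factor 2 at most; passing from the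
  admissible graphs to the subgroups costs nothing, as all fibres have the same size.
\<close>

lemma rank_second_moment:
  assumes A: "finite A" and n: "n > 0"
    and half: "real (card (A_graphs A {..<n})) \<le> 2 * real (card (standard_graphs A n))"
  defines "\<mu> \<equiv> (real (card A) - 1) * real n - real (card A) * sqrt (real n) + 1"
  shows "(\<Sum>H\<in>subgroups_of_size A n. (real (subgroup_rank (free_group A) H) - \<mu>)\<^sup>2) \<le>
         real (card (subgroups_of_size A n)) * (2 * (real (card A))\<^sup>2 * (sqrt (real n) + 1))"
proof -
  let ?G = "A_graphs A {..<n}" and ?S = "subgroups_of_size A n" and ?r = "real (card A)"
  have sub: "standard_graphs A n \<subseteq> ?G"
    by (auto simp: standard_graphs_def A_graphs_def admissible_def)
  have "fact (n - 1) * (\<Sum>H\<in>?S. (real (subgroup_rank (free_group A) H) - \<mu>)\<^sup>2) =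
      (\<Sum>E\<in>standard_graphs A n. (real (subgroup_rank (free_group A) (closed_words E 0)) - \<mu>)\<^sup>2)"
    by (rule sum_standard_graphs(1)[OF A n, symmetric])
  also have "\<dots> = (\<Sum>E\<in>standard_graphs A n. (?r * (real n - sqrt (real n)) - real (card E))\<^sup>2)"
  proof (rule sum.cong)
    fix E assume "E \<in> standard_graphs A n"
    then have "subgroup_rank (free_group A) (closed_words E 0) + n = card E + 1"
      using rank_closed_words(2)[OF A, of "{..<n}" E 0] by (simp add: standard_graphs_def)
    then have "real (subgroup_rank (free_group A) (closed_words E 0)) + real n = real (card E) + 1"
      by (metis of_nat_add of_nat_1)
    then have "real (subgroup_rank (free_group A) (closed_words E 0)) - \<mu> =
        - (?r * (real n - sqrt (real n)) - real (card E))"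
      by (simp add: \<mu>_def algebra_simps)
    then show "(real (subgroup_rank (free_group A) (closed_words E 0)) - \<mu>)\<^sup>2 =
        (?r * (real n - sqrt (real n)) - real (card E))\<^sup>2"
      by (simp only: power2_minus)
  qed simp
  also have "\<dots> \<le> (\<Sum>E\<in>?G. (?r * (real n - sqrt (real n)) - real (card E))\<^sup>2)"
    using sub finite_A_graphs[OF A finite_lessThan] by (intro sum_mono2) auto
  also have "\<dots> \<le> real (card ?G) * (?r\<^sup>2 * (sqrt (real n) + 1))"
    using second_moment_A_graphs[OF A, of "{..<n}"] by simp
  also have "\<dots> \<le> 2 * real (card (standard_graphs A n)) * (?r\<^sup>2 * (sqrt (real n) + 1))"
    using half by (intro mult_right_mono) auto
  also have "real (card (standard_graphs A n)) = fact (n - 1) * real (card ?S)"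
    using sum_standard_graphs(1)[OF A n, of "\<lambda>_. 1"] by simp
  finally have "fact (n - 1) * (\<Sum>H\<in>?S. (real (subgroup_rank (free_group A) H) - \<mu>)\<^sup>2) \<le>
      fact (n - 1) * (real (card ?S) * (2 * ?r\<^sup>2 * (sqrt (real n) + 1)))"
    by (simp add: mult_ac)
  then show ?thesis
    by (rule mult_left_le_imp_le) simp
qed

text \<open>
  The second moment about \<open>\<mu>\<close> is the variance plus the squared distance of the mean from \<open>\<mu>\<close>.
\<close>

lemma mean_variance_pmf_of_set:
  fixes f :: "'b \<Rightarrow> real"
  assumes S: "finite S" "S \<noteq> {}" and bound: "(\<Sum>x\<in>S. (f x - \<mu>)\<^sup>2) \<le> real (card S) * B"
  shows "\<bar>measure_pmf.expectation (pmf_of_set S) f - \<mu>\<bar> \<le> sqrt B"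
    and "measure_pmf.variance (pmf_of_set S) f \<le> B"
proof -
  let ?M = "measure_pmf.expectation (pmf_of_set S) f" and ?m = "real (card S)"
  have m: "?m > 0" using S by (simp add: card_gt_0_iff)
  have M: "?m * ?M = (\<Sum>x\<in>S. f x)"
    using m by (simp add: integral_pmf_of_set[OF S(2,1)])
  have var: "?m * measure_pmf.variance (pmf_of_set S) f = (\<Sum>x\<in>S. (f x - ?M)\<^sup>2)"
    using m by (simp add: integral_pmf_of_set[OF S(2,1), of "\<lambda>x. (f x - ?M)\<^sup>2"])
  have "(\<Sum>x\<in>S. (f x - \<mu>)\<^sup>2) = (\<Sum>x\<in>S. (f x - ?M)\<^sup>2 + 2 * (?M - \<mu>) * (f x - ?M) + (?M - \<mu>)\<^sup>2)"
    by (intro sum.cong) (simp_all add: power2_eq_square algebra_simps)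
  also have "\<dots> = (\<Sum>x\<in>S. (f x - ?M)\<^sup>2) + 2 * (?M - \<mu>) * ((\<Sum>x\<in>S. f x) - ?m * ?M) + ?m * (?M - \<mu>)\<^sup>2"
    by (simp add: sum.distrib sum_subtractf flip: sum_distrib_left)
  also have "\<dots> = ?m * (measure_pmf.variance (pmf_of_set S) f + (?M - \<mu>)\<^sup>2)"
    by (simp only: M var[symmetric]) (simp add: algebra_simps)
  finally have "?m * (measure_pmf.variance (pmf_of_set S) f + (?M - \<mu>)\<^sup>2) \<le> ?m * B"
    using bound by simp
  then have le: "measure_pmf.variance (pmf_of_set S) f + (?M - \<mu>)\<^sup>2 \<le> B"
    using m by simp
  then show "measure_pmf.variance (pmf_of_set S) f \<le> B"
    using zero_le_power2[of "?M - \<mu>"] by linarith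
  have "0 \<le> ?m * measure_pmf.variance (pmf_of_set S) f"
    unfolding var by (intro sum_nonneg) simp
  then have "0 \<le> measure_pmf.variance (pmf_of_set S) f"
    using m by (simp add: zero_le_mult_iff)
  with le have "(?M - \<mu>)\<^sup>2 \<le> B" by linarith
  then have "sqrt ((?M - \<mu>)\<^sup>2) \<le> sqrt B" by (rule real_sqrt_le_mono)
  then show "\<bar>?M - \<mu>\<bar> \<le> sqrt B" by simp
qed

theorem corollary4p1:
  fixes A :: "'a set"
  assumes "finite A" and "card A \<ge> 2"
  shows "(\<lambda>n. average_rank A n - ((real (card A) - 1) * real n - real (card A) * sqrt (real n) + 1))
           \<in> o(\<lambda>n. sqrt (real n))
       \<and> (\<lambda>n. rank_std_deviation A n) \<in> o(\<lambda>n. sqrt (real n))"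
proof -
  define r where "r = real (card A)"
  define b where "b n = sqrt (2 * r\<^sup>2 * (sqrt (real n) + 1))" for n
  let ?\<mu> = "\<lambda>n. (real (card A) - 1) * real n - real (card A) * sqrt (real n) + 1"
  have "r > 0" using assms(2) by (simp add: r_def)
  then have b: "b \<in> o(\<lambda>n. sqrt (real n))"
    unfolding b_def by real_asymp
  have ev: "\<forall>\<^sub>F n in sequentially. \<bar>average_rank A n - ?\<mu> n\<bar> \<le> b n \<and> \<bar>rank_std_deviation A n\<bar> \<le> b n"
    using eventually_half_admissible[OF assms, where 'v = nat] eventually_gt_at_top[of 0]
  proof eventually_elim
    case (elim n)
    then have n: "n > 0" by simp
    have half: "real (card (A_graphs A {..<n})) \<le> 2 * real (card (standard_graphs A n))"
      using elim(1)[rule_format, of "{..<n}" 0] n by (simp add: standard_graphs_def)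
    let ?S = "subgroups_of_size A n"
    have "{} \<in> A_graphs A {..<n}"
      by (auto simp: A_graphs_def intro: A_graphI)
    then have "card (A_graphs A {..<n}) > 0"
      using finite_A_graphs[OF assms(1), of "{..<n}"] by (auto simp: card_gt_0_iff)
    then have "standard_graphs A n \<noteq> {}"
      using half by auto
    then have S: "finite ?S" "?S \<noteq> {}"
      using sum_standard_graphs(2)[OF assms(1) n] subgroups_of_size_eq[OF assms(1) n] by auto
    note bounds = mean_variance_pmf_of_set[OF S rank_second_moment[OF assms(1) n half]]
    have "0 \<le> rank_std_deviation A n"
      unfolding rank_std_deviation_def random_subgroup_def
      by (intro real_sqrt_ge_zero integral_nonneg_AE) simp
    then show ?case
      using bounds(1) real_sqrt_le_mono[OF bounds(2)]
      by (simp add: average_rank_def rank_std_deviation_def random_subgroup_def b_def r_def)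
  qed
  have "(\<lambda>n. average_rank A n - ?\<mu> n) \<in> O(b)"
    by (rule bigoI[of _ 1]) (use ev in eventually_elim, auto)
  moreover have "(\<lambda>n. rank_std_deviation A n) \<in> O(b)"
    by (rule bigoI[of _ 1]) (use ev in eventually_elim, auto)
  ultimately show ?thesis
    using b landau_o.big_small_trans by blast
qed

end
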